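(* For every $t\in\{0,1,\dots,T\}$ the value function can be written as $$V_t^*(\sigma)=\sup_{\alpha_t^i\in\Gamma_t}\langle\alpha_t^i,\sigma\rangle ,$$ i.e. there is a set $\Gamma_t$ of functions $\alpha_t^i:\mathcal{S}\to\mathbb{R}$ (the $\alpha$-functions), not depending on $\sigma$, such that this identity holds for every sufficient statistic $\sigma$.
   Context: Hybrid system. The state is $s=(x,q)\in\mathcal{S}=\mathcal{X}\times\mathcal{Q}$ with $\mathcal{X}\subseteq\mathbb{R}^n$ and $\mathcal{Q}$ a finite set of $N_q$ modes (functions on $\mathcal{X}$ are extended by zero to $\mathbb{R}^n$). The control space $\mathcal{U}$ is a compact Borel space. The transition kernel has the form $\tau(x',q'\mid x,q,u)=T_x(x'\mid x,u,q')\,T_q(q'\mid x,q,u)$, where $T_q(\cdot\mid x,q,u)$ is a probability distribution on $\mathcal{Q}$ and $T_x(\cdot\mid x,u,q')$ is a probability density on $\mathbb{R}^n$, both measurable in their arguments. $K\subseteq\mathcal{X}\times\mathcal{Q}$ is a Borel set (the safe set), $\mathbf{1}_K$ its indicator function, and $T\in\mathbb{N}$ the time horizon. Observations. $y=(y^x,y^q)$. The component $y^q$ takes values in a finite set of $N_{y^q}$ elements, and $Q_{q,y^q}(u)$ is the probability of observing $y^q$ when the mode is $q$ and the preceding control was $u$. The component $y^x$ is of one of two types: (continuous) $y^x\in\mathbb{R}^n$, $y^x=h(x,u)+v$ with $h$ bounded and continuous and $v$ having positive probability density $\varphi$; (discrete) $y^x$ takes values in a finite set of $N_{y^x}$ elements,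 with $\varphi(y^x\mid x,u)$ the probability of observing $y^x$ when the continuous state is $x$ and the preceding control was $u$. Sufficient statistics are nonnegative integrable functions $\sigma$ on $\mathcal{S}$, and $\langle f,g\rangle=\sum_{q\in\mathcal{Q}}\int_{\mathbb{R}^n} f(x,q)g(x,q)\,dx$. Update operator. In the discrete case $$\Phi_{y,u}[\sigma](x',q')=N_{y^q}N_{y^x}\,Q_{q',y^q}(u)\,\varphi(y^x\mid x',u)\sum_{q\in\mathcal{Q}}\int_{\mathbb{R}^n}\mathbf{1}_K(x,q)\,\tau(x',q'\mid x,q,u)\,\sigma(x,q)\,dx,$$ and in the continuous case $N_{y^x}\varphi(y^x\mid x',u)$ is replaced by $\varphi(y^x-h(x',u))/\varphi(y^x)$. Value functions. $V_T^*(\sigma)=\langle\sigma,\mathbf{1}_K\rangle$ and, for $t<T$, $V_t^*(\sigma)=\sup_{u\in\mathcal{U}}\mathbb{E}^{\dagger}[V_{t+1}^*(\Phi_{y,u}[\sigma])]$. Here $\mathbb{E}^\dagger$ is expectation over $y$ under the reference measure: $y^q$ is uniform on its $N_{y^q}$ values, independent of $y^x$, and $y^x$ has density $\varphi$ (continuous case) or is uniform on its $N_{y^x}$ values (discrete case). *)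

theory Defs
  imports "HOL-Probability.Probability"
begin

text \<open>
  Modes, mode observations and discrete state observations are elements of finite types.
  Functions on the hybrid state space \<open>X \<times> UNIV\<close> are represented by their extension by zero to
  \<open>(real ^ 'n) \<times> 'q\<close>; the kernels and observation maps are constrained only at states in \<open>X\<close>
  and controls in \<open>U\<close>.
\<close>

type_synonym ('n, 'q) state = "(real ^ 'n) \<times> 'q"

definition pairing ::
  "(('n::finite, 'q::finite) state \<Rightarrow> real) \<Rightarrow> (('n, 'q) state \<Rightarrow> real) \<Rightarrow> real" where
  "pairing f g = (\<Sum>q\<in>UNIV. \<integral>x. f (x, q) * g (x, q) \<partial>lborel)"

definition sufficient_statistic ::
  "(real ^ 'n::finite) set \<Rightarrow> (('n, 'q::finite) state \<Rightarrow> real) \<Rightarrow> bool" where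
  "sufficient_statistic X \<sigma> \<longleftrightarrow>
     (\<forall>x q. 0 \<le> \<sigma> (x, q)) \<and>
     (\<forall>q. integrable lborel (\<lambda>x. \<sigma> (x, q))) \<and>
     (\<forall>x q. x \<notin> X \<longrightarrow> \<sigma> (x, q) = 0)"

text \<open>
  The last two conditions make \<open>pairing \<alpha> \<sigma>\<close> a sum of genuine Lebesgue integrals for every
  sufficient statistic, rather than possibly the default value 0 of a non-integrable function.
\<close>

definition alpha_function ::
  "(real ^ 'n::finite) set \<Rightarrow> (('n, 'q::finite) state \<Rightarrow> real) \<Rightarrow> bool" where
  "alpha_function X \<alpha> \<longleftrightarrow>
     (\<forall>x q. x \<notin> X \<longrightarrow> \<alpha> (x, q) = 0) \<and>
     (\<forall>q. (\<lambda>x. \<alpha> (x, q)) \<in> borel_measurable borel) \<and>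
     (\<forall>\<sigma>. sufficient_statistic X \<sigma> \<longrightarrow>
        (\<forall>q. integrable lborel (\<lambda>x. \<alpha> (x, q) * \<sigma> (x, q))))"

text \<open>
  A compact Borel space is a compact metrizable space, hence, up to homeomorphism, a compact
  subset of a Polish space.  Argument order: \<open>Tq q' x q u\<close> is $T_q(q' \mid x, q, u)$ and
  \<open>Tx x' x u q'\<close> is $T_x(x' \mid x, u, q')$.
\<close>

definition hybrid_system ::
  "(real ^ 'n::finite) set \<Rightarrow> ('n, 'q::finite) state set \<Rightarrow> 'u::polish_space set \<Rightarrow>
   ('q \<Rightarrow> real ^ 'n \<Rightarrow> 'q \<Rightarrow> 'u \<Rightarrow> real) \<Rightarrow>
   (real ^ 'n \<Rightarrow> real ^ 'n \<Rightarrow> 'u \<Rightarrow> 'q \<Rightarrow> real) \<Rightarrow> bool" where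
  "hybrid_system X K U Tq Tx \<longleftrightarrow>
     K \<subseteq> X \<times> UNIV \<and>
     K \<in> sets (borel \<Otimes>\<^sub>M count_space UNIV) \<and>
     compact U \<and> U \<noteq> {} \<and>
     (\<forall>q' q. (\<lambda>(x, u). Tq q' x q u)
        \<in> borel_measurable (restrict_space borel X \<Otimes>\<^sub>M restrict_space borel U)) \<and>
     (\<forall>x\<in>X. \<forall>q. \<forall>u\<in>U. (\<forall>q'. 0 \<le> Tq q' x q u) \<and> (\<Sum>q'\<in>UNIV. Tq q' x q u) = 1) \<and>
     (\<forall>q'. (\<lambda>(x', x, u). Tx x' x u q')
        \<in> borel_measurable (borel \<Otimes>\<^sub>M (restrict_space borel X \<Otimes>\<^sub>M restrict_space borel U))) \<and>
     (\<forall>x\<in>X. \<forall>u\<in>U. \<forall>q'. (\<forall>x'. 0 \<le> Tx x' x u q') \<and>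
        has_bochner_integral lborel (\<lambda>x'. Tx x' x u q') 1)"

definition mode_observation ::
  "'u set \<Rightarrow> ('q::finite \<Rightarrow> 'yq::finite \<Rightarrow> 'u \<Rightarrow> real) \<Rightarrow> bool" where
  "mode_observation U Q \<longleftrightarrow>
     (\<forall>q. \<forall>u\<in>U. (\<forall>yq. 0 \<le> Q q yq u) \<and> (\<Sum>yq\<in>UNIV. Q q yq u) = 1)"

definition continuous_observation ::
  "(real ^ 'n::finite) set \<Rightarrow> 'u::polish_space set \<Rightarrow>
   (real ^ 'n \<Rightarrow> 'u \<Rightarrow> real ^ 'n) \<Rightarrow> (real ^ 'n \<Rightarrow> real) \<Rightarrow> bool" where
  "continuous_observation X U h \<phi> \<longleftrightarrow>
     continuous_on (X \<times> U) (\<lambda>(x, u). h x u) \<and>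
     bounded ((\<lambda>(x, u). h x u) ` (X \<times> U)) \<and>
     (\<forall>v. 0 < \<phi> v) \<and>
     has_bochner_integral lborel \<phi> 1"

definition discrete_observation ::
  "(real ^ 'n::finite) set \<Rightarrow> 'u::polish_space set \<Rightarrow>
   ('yx::finite \<Rightarrow> real ^ 'n \<Rightarrow> 'u \<Rightarrow> real) \<Rightarrow> bool" where
  "discrete_observation X U \<phi> \<longleftrightarrow>
     (\<forall>yx. (\<lambda>(x, u). \<phi> yx x u)
        \<in> borel_measurable (restrict_space borel X \<Otimes>\<^sub>M restrict_space borel U)) \<and>
     (\<forall>x\<in>X. \<forall>u\<in>U. (\<forall>yx. 0 \<le> \<phi> yx x u) \<and> (\<Sum>yx\<in>UNIV. \<phi> yx x u) = 1)"

definition transition_kernel ::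
  "('q \<Rightarrow> real ^ 'n \<Rightarrow> 'q \<Rightarrow> 'u \<Rightarrow> real) \<Rightarrow> (real ^ 'n \<Rightarrow> real ^ 'n \<Rightarrow> 'u \<Rightarrow> 'q \<Rightarrow> real) \<Rightarrow>
   ('n::finite, 'q) state \<Rightarrow> ('n, 'q) state \<Rightarrow> 'u \<Rightarrow> real" where
  "transition_kernel Tq Tx = (\<lambda>(x', q') (x, q) u. Tx x' x u q' * Tq q' x q u)"

definition safe_prediction ::
  "('n::finite, 'q::finite) state set \<Rightarrow>
   ('q \<Rightarrow> real ^ 'n \<Rightarrow> 'q \<Rightarrow> 'u \<Rightarrow> real) \<Rightarrow> (real ^ 'n \<Rightarrow> real ^ 'n \<Rightarrow> 'u \<Rightarrow> 'q \<Rightarrow> real) \<Rightarrow>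
   'u \<Rightarrow> (('n, 'q) state \<Rightarrow> real) \<Rightarrow> ('n, 'q) state \<Rightarrow> real" where
  "safe_prediction K Tq Tx u \<sigma> s' =
     (\<Sum>q\<in>UNIV. \<integral>x. indicator K (x, q) * transition_kernel Tq Tx s' (x, q) u * \<sigma> (x, q) \<partial>lborel)"

text \<open>
  The updated statistics are functions on \<open>X \<times> UNIV\<close>, extended by zero.  If the densities
  \<open>Tx\<close> charge the complement of \<open>X\<close>, the mass there is unsafe, since \<open>K \<subseteq> X \<times> UNIV\<close>,
  and does not contribute to any later value.
\<close>

definition update_continuous ::
  "(real ^ 'n::finite) set \<Rightarrow> ('n, 'q::finite) state set \<Rightarrow>
   ('q \<Rightarrow> real ^ 'n \<Rightarrow> 'q \<Rightarrow> 'u \<Rightarrow> real) \<Rightarrow> (real ^ 'n \<Rightarrow> real ^ 'n \<Rightarrow> 'u \<Rightarrow> 'q \<Rightarrow> real) \<Rightarrow>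
   ('q \<Rightarrow> 'yq::finite \<Rightarrow> 'u \<Rightarrow> real) \<Rightarrow>
   (real ^ 'n \<Rightarrow> 'u \<Rightarrow> real ^ 'n) \<Rightarrow> (real ^ 'n \<Rightarrow> real) \<Rightarrow>
   (real ^ 'n) \<times> 'yq \<Rightarrow> 'u \<Rightarrow> (('n, 'q) state \<Rightarrow> real) \<Rightarrow> ('n, 'q) state \<Rightarrow> real" where
  "update_continuous X K Tq Tx Q h \<phi> = (\<lambda>(yx, yq) u \<sigma> (x', q').
     if x' \<in> X
     then real CARD('yq) * Q q' yq u * (\<phi> (yx - h x' u) / \<phi> yx)
            * safe_prediction K Tq Tx u \<sigma> (x', q')
     else 0)"

definition update_discrete ::
  "(real ^ 'n::finite) set \<Rightarrow> ('n, 'q::finite) state set \<Rightarrow>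
   ('q \<Rightarrow> real ^ 'n \<Rightarrow> 'q \<Rightarrow> 'u \<Rightarrow> real) \<Rightarrow> (real ^ 'n \<Rightarrow> real ^ 'n \<Rightarrow> 'u \<Rightarrow> 'q \<Rightarrow> real) \<Rightarrow>
   ('q \<Rightarrow> 'yq::finite \<Rightarrow> 'u \<Rightarrow> real) \<Rightarrow>
   ('yx::finite \<Rightarrow> real ^ 'n \<Rightarrow> 'u \<Rightarrow> real) \<Rightarrow>
   'yx \<times> 'yq \<Rightarrow> 'u \<Rightarrow> (('n, 'q) state \<Rightarrow> real) \<Rightarrow> ('n, 'q) state \<Rightarrow> real" where
  "update_discrete X K Tq Tx Q \<phi> = (\<lambda>(yx, yq) u \<sigma> (x', q').
     if x' \<in> X
     then real CARD('yq) * real CARD('yx) * Q q' yq u * \<phi> yx x' u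
            * safe_prediction K Tq Tx u \<sigma> (x', q')
     else 0)"

definition reference_continuous ::
  "(real ^ 'n::finite \<Rightarrow> real) \<Rightarrow> ((real ^ 'n) \<times> 'yq::finite) measure" where
  "reference_continuous \<phi> = density lborel (\<lambda>v. ennreal (\<phi> v)) \<Otimes>\<^sub>M uniform_count_measure UNIV"

definition reference_discrete :: "('yx::finite \<times> 'yq::finite) measure" where
  "reference_discrete = uniform_count_measure UNIV \<Otimes>\<^sub>M uniform_count_measure UNIV"

text \<open>
  \<open>R\<close> is the reference distribution of the observation and \<open>\<Phi>\<close> the update operator.  All
  values are nonnegative, so the expectation is taken as an integral with values in
  $[0, \infty]$.  A Bochner integral would not do: for a null set of observations
  \<open>y\<close> the function \<open>\<Phi> y u \<sigma>\<close> need not be integrable, and the integrand need not be Borel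
  measurable there; the nonnegative integral ignores null sets without any measurability condition.
\<close>

function value_function ::
  "nat \<Rightarrow> ('n::finite, 'q::finite) state set \<Rightarrow> 'u set \<Rightarrow> 'y measure \<Rightarrow>
   ('y \<Rightarrow> 'u \<Rightarrow> (('n, 'q) state \<Rightarrow> real) \<Rightarrow> ('n, 'q) state \<Rightarrow> real) \<Rightarrow>
   nat \<Rightarrow> (('n, 'q) state \<Rightarrow> real) \<Rightarrow> ennreal" where
  "value_function T K U R \<Phi> t \<sigma> =
     (if t < T
      then (SUP u\<in>U. \<integral>\<^sup>+ y. value_function T K U R \<Phi> (Suc t) (\<Phi> y u \<sigma>) \<partial>R)
      else ennreal (pairing \<sigma> (indicator K)))"
  by pat_completeness auto
termination
  by (relation "Wellfounded.measure (\<lambda>(T, K, U, R, \<Phi>, t, \<sigma>). T - t)") auto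

declare value_function.simps [simp del]

end

theory Submission
  imports Defs
begin

text \<open>
  Backward induction.  If \<open>V\<^sub>t\<^sub>+\<^sub>1\<close> is the supremum of the pairings with a \<^emph>\<open>countable\<close> family \<open>a\<^sub>n\<close>, then
  the expectation of \<open>sup\<^sub>n \<langle>a\<^sub>n, \<Phi>\<^bsub>y,u\<^esub>[\<sigma>]\<rangle>\<close> over \<open>y\<close> is the supremum, over measurable selections \<open>c\<close> of an
  index \<open>c(y)\<close>, of the expectation of \<open>\<langle>a\<^bsub>c(y)\<^esub>, \<Phi>\<^bsub>y,u\<^esub>[\<sigma>]\<rangle>\<close>, and by Fubini the latter is the pairing of \<open>\<sigma>\<close> with
  a function depending only on \<open>u\<close> and \<open>c\<close>.  The new family is uncountable, but its members lie between
  0 and \<open>1\<^sub>K\<close>; as \<open>L\<^sup>1\<close> is separable, a countable subfamily has the same supremum at every \<open>\<sigma>\<close>, and the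
  induction continues.

  Since \<open>X\<close> need not be a Borel set, an updated statistic need not be measurable.  All functions are
  therefore considered on \<open>K\<close> only, which is enough because every value depends on \<open>1\<^sub>K \<sigma>\<close> alone.
\<close>

subsection \<open>Separability of $L^1$\<close>

text \<open>Functions are used rather than classes modulo null sets. Integrability of the members is
  demanded because the integral of a non-integrable function defaults to 0, so a non-integrable
  \<open>d\<close> could pass as close to every \<open>f\<close>.\<close>

definition L1_dense :: "'a measure \<Rightarrow> ('a \<Rightarrow> real) set \<Rightarrow> bool" where
  "L1_dense M D \<longleftrightarrow> (\<forall>d\<in>D. integrable M d) \<and>
     (\<forall>f. integrable M f \<longrightarrow> (\<forall>e>0. \<exists>d\<in>D. (\<integral>x. \<bar>f x - d x\<bar> \<partial>M) < e))"

text \<open>By Lindelof, countably many basis sets cover \<open>W\<close>. Their finite unions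
  increase to \<open>W\<close>, so continuity of measure from above, which needs \<open>W\<close> to
  have finite measure, makes the uncovered remainder small.\<close>

lemma open_approx_finite_Union_basis:
  fixes W :: "'a::euclidean_space set"
  assumes B: "topological_basis B" and W: "open W" "emeasure lborel W < \<infinity>" and "0 < (e::real)"
  obtains F where "finite F" "F \<subseteq> B" "\<Union>F \<subseteq> W" "emeasure lborel (W - \<Union>F) < e"
proof (cases "W = {}")
  case True
  then show ?thesis using that[of "{}"] \<open>0 < e\<close> by auto
next
  case False
  obtain B0 where B0: "B0 \<subseteq> B" "\<Union>B0 = W"
    using B W(1) unfolding topological_basis_def by blast
  obtain B1 where B1: "countable B1" "B1 \<subseteq> B0" "\<Union>B1 = W"
    using Lindelof[of B0] B0 B by (metis subsetD topological_basis_open)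
  \<comment> \<open>\<open>N n\<close> holds the first \<open>n\<close> terms of an enumeration of
    \<open>B1\<close>, with repetitions if \<open>B1\<close> is finite.\<close>
  define N where "N n = from_nat_into B1 ` {..<n::nat}" for n
  have ne: "B1 \<noteq> {}" using False B1 by auto
  have ran: "range (from_nat_into B1) = B1" using B1 ne by (simp add: range_from_nat_into)
  have sub: "N n \<subseteq> B1" for n using ran by (auto simp: N_def)
  have op: "open (\<Union>(N n))" for n
    using sub[of n] B1(2) B0(1) by (intro open_Union) (auto intro: topological_basis_open[OF B])
  have UN: "(\<Inter>n. W - \<Union>(N n)) = {}"
  proof -
    have "x \<in> (\<Union>n. \<Union>(N n))" if x: "x \<in> W" for x
    proof -
      obtain b where "b \<in> B1" "x \<in> b" using B1(3) x by blast
      then obtain k where "from_nat_into B1 k = b" using ran by (metis imageE)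
      then have "b \<in> N (Suc k)" by (auto simp: N_def)
      then show ?thesis using \<open>x \<in> b\<close> by blast
    qed
    then show ?thesis by blast
  qed
  have "(\<lambda>n. emeasure lborel (W - \<Union>(N n))) \<longlonglongrightarrow> emeasure lborel (\<Inter>n. W - \<Union>(N n))"
  proof (rule Lim_emeasure_decseq)
    show "range (\<lambda>n. W - \<Union>(N n)) \<subseteq> sets lborel" using W op by auto
    show "decseq (\<lambda>n. W - \<Union>(N n))" by (fastforce simp: decseq_def N_def)
    show "emeasure lborel (W - \<Union>(N n)) \<noteq> \<infinity>" for n
      using W emeasure_mono[of "W - \<Union>(N n)" W lborel] by (auto simp: top_unique)
  qed
  then have "(\<lambda>n. emeasure lborel (W - \<Union>(N n))) \<longlonglongrightarrow> 0" by (simp only: UN emeasure_empty)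
  then have "eventually (\<lambda>n. emeasure lborel (W - \<Union>(N n)) < e) sequentially"
    by (rule order_tendstoD) (use \<open>0 < e\<close> in auto)
  then obtain n where "emeasure lborel (W - \<Union>(N n)) < e" by (auto simp: eventually_sequentially)
  then show ?thesis using that[of "N n"] sub[of n] B1 B0 by (auto simp: N_def)
qed

text \<open>Dominated convergence with majorant \<open>3 * \<bar>f x\<bar>\<close>. The factor 2 in
  the hypothesis is the one supplied by the limit case of \<open>integrable_induct\<close>.\<close>

lemma tendsto_L1_dominated:
  fixes f :: "'a \<Rightarrow> real"
  assumes lim: "\<And>i. integrable M (s i)" "integrable M f"
    "\<And>x. x \<in> space M \<Longrightarrow> (\<lambda>i. s i x) \<longlonglongrightarrow> f x"
    "\<And>i x. x \<in> space M \<Longrightarrow> \<bar>s i x\<bar> \<le> 2 * \<bar>f x\<bar>"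
  shows "(\<lambda>i. \<integral>x. \<bar>f x - s i x\<bar> \<partial>M) \<longlonglongrightarrow> 0"
proof -
  have "(\<lambda>i. \<integral>x. \<bar>f x - s i x\<bar> \<partial>M) \<longlonglongrightarrow> (\<integral>x. 0 \<partial>M)"
  proof (rule integral_dominated_convergence)
    show "integrable M (\<lambda>x. 3 * \<bar>f x\<bar>)" using lim by auto
    show "AE x in M. (\<lambda>i. \<bar>f x - s i x\<bar>) \<longlonglongrightarrow> 0"
    proof (rule AE_I2)
      fix x assume "x \<in> space M"
      from tendsto_diff[OF tendsto_const[of "f x"] lim(3)[OF this]]
      show "(\<lambda>i. \<bar>f x - s i x\<bar>) \<longlonglongrightarrow> 0" using tendsto_rabs_zero by fastforce
    qed
    show "AE x in M. norm \<bar>f x - s i x\<bar> \<le> 3 * \<bar>f x\<bar>" for i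
      by (rule AE_I2) (use lim(4)[of _ i] in \<open>fastforce\<close>)
  qed (use lim in auto)
  then show ?thesis by simp
qed

text \<open>The dense set consists of the rational combinations of indicators of finite unions of
  basis sets. Outer regularity brings indicators of sets of finite measure within reach; sums and
  dominated limits follow by induction over integrable functions.\<close>

lemma L1_separable_lborel:
  "\<exists>D :: ('a::euclidean_space \<Rightarrow> real) set. countable D \<and> L1_dense lborel D"
proof -
  obtain B :: "'a set set" where B: "countable B" "topological_basis B"
    using ex_countable_basis by blast
  define C where "C = {G \<in> Union ` {F. F \<subseteq> B \<and> finite F}. emeasure lborel G < \<infinity>}"
  have cC: "countable C"
  proof (rule countable_subset)
    show "C \<subseteq> Union ` {F. finite F \<and> F \<subseteq> B}" by (auto simp: C_def)
    show "countable (Union ` {F. finite F \<and> F \<subseteq> B})"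
      using countable_Collect_finite_subset[OF B(1)] by simp
  qed
  have Cs: "G \<in> sets lborel" "emeasure lborel G < \<infinity>" if "G \<in> C" for G
  proof -
    have "open G" using that topological_basis_open[OF B(2)] by (auto simp: C_def)
    then show "G \<in> sets lborel" by simp
  qed (use that in \<open>simp add: C_def\<close>)
  \<comment> \<open>Lists of coefficients and sets encode the combinations: lists over a countable
    set are countable, and appending two lists adds the functions.\<close>
  define val :: "(rat \<times> 'a set) list \<Rightarrow> 'a \<Rightarrow> real"
    where "val l x = (\<Sum>(r, G)\<leftarrow>l. of_rat r * indicator G x)" for l x
  define D where "D = val ` lists (UNIV \<times> C)"
  have cD: "countable D" unfolding D_def using cC by auto
  have intD: "integrable lborel (val l)" if "l \<in> lists (UNIV \<times> C)" for l
    using that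
  proof (induction l)
    case Nil
    then show ?case by (simp add: val_def[abs_def])
  next
    case (Cons a l)
    obtain r G where a: "a = (r, G)" by (cases a)
    have eq: "val (a # l) = (\<lambda>x. of_rat r * indicator G x + val l x)"
      by (auto simp: val_def a)
    have "G \<in> C" using Cons a by auto
    show ?case unfolding eq
      using Cons Cs[OF \<open>G \<in> C\<close>] by (auto intro!: Bochner_Integration.integrable_add integrable_mult_right integrable_real_indicator)
  qed
  have dense: "\<forall>e>0. \<exists>d\<in>D. (\<integral>x. \<bar>f x - d x\<bar> \<partial>lborel) < e" if "integrable lborel f" for f
    using that
  proof (induction rule: integrable_induct)
    case (base A c)
    show ?case
    proof (intro allI impI)
      fix e :: real assume "0 < e"
      \<comment> \<open>Error budget: replacing \<open>c\<close> by a rational \<open>q\<close> on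
        \<open>A\<close> costs less than \<open>e / 2\<close>; replacing \<open>A\<close> by
        \<open>V\<close> costs |q| times the measures of \<open>W - A\<close> and
        \<open>W - V\<close>, less than \<open>e1\<close> each, which is again at most
        \<open>e / 2\<close>. The added 1 keeps the denominators nonzero when \<open>m\<close> or
        \<open>q\<close> vanishes.\<close>
      define m where "m = measure lborel A"
      have "0 \<le> m" by (simp add: m_def)
      have "0 < e / (2 * (m + 1))" using \<open>0 < e\<close> \<open>0 \<le> m\<close> by simp
      then obtain r :: rat where r: "\<bar>c - of_rat r\<bar> < e / (2 * (m + 1))"
        using of_rat_dense[of "c - e / (2 * (m + 1))" "c + e / (2 * (m + 1))"] by (auto simp: abs_less_iff) (smt (verit))
      define q :: real where "q = of_rat r"
      define e1 where "e1 = e / (4 * (\<bar>q\<bar> + 1))"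
      have "0 < \<bar>q\<bar> + (1::real)" by linarith
      then have "0 < e1" unfolding e1_def using \<open>0 < e\<close> by (intro divide_pos_pos mult_pos_pos) auto
      have A: "A \<in> sets borel" using base by simp
      obtain W where W: "open W" "A \<subseteq> W" "emeasure lborel (W - A) < e1"
        using outer_regular_lborel[OF A \<open>0 < e1\<close>] by blast
      have "emeasure lborel W = emeasure lborel A + emeasure lborel (W - A)"
        using W A by (subst plus_emeasure) (auto intro!: arg_cong2[where f=emeasure])
      also have "\<dots> < \<infinity>" using base W(3) by (auto simp: less_top[symmetric] top_unique dest: order.strict_trans)
      finally have Wf: "emeasure lborel W < \<infinity>" .
      obtain F where F: "finite F" "F \<subseteq> B" "\<Union>F \<subseteq> W" "emeasure lborel (W - \<Union>F) < e1"
        using open_approx_finite_Union_basis[OF B(2) W(1) Wf \<open>0 < e1\<close>] by blast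
      define V where "V = \<Union>F"
      have Vo: "open V" unfolding V_def using F(2) topological_basis_open[OF B(2)] by (intro open_Union) auto
      have "emeasure lborel V \<le> emeasure lborel W"
        using F(3) W(1) by (intro emeasure_mono) (auto simp: V_def)
      then have "emeasure lborel V < \<infinity>" using Wf by (rule le_less_trans)
      then have V: "V \<in> C" using F by (auto simp: C_def V_def)
      have val1: "val [(r, V)] x = q * indicator V x" for x by (simp add: val_def q_def)
      have d: "val [(r, V)] \<in> D" using V by (auto simp: D_def intro!: imageI)
      have iA: "integrable lborel (indicator A :: 'a \<Rightarrow> real)"
        using base by (intro integrable_real_indicator) auto
      have f1: "emeasure lborel (W - A) < \<infinity>" "emeasure lborel (W - V) < \<infinity>"
        using W(3) F(4) by (auto simp: V_def less_top[symmetric] dest: order.strict_trans)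
      have i1: "integrable lborel (indicator (W - A) :: 'a \<Rightarrow> real)"
        "integrable lborel (indicator (W - V) :: 'a \<Rightarrow> real)"
        using f1 W(1) A Vo by (auto intro!: integrable_real_indicator)
      have m1: "measure lborel (W - A) < e1" "measure lborel (W - V) < e1"
        using W(3) F(4) f1 by (auto simp: V_def emeasure_eq_ennreal_measure ennreal_less_iff)
      have "(\<integral>x. \<bar>indicator A x *\<^sub>R c - val [(r, V)] x\<bar> \<partial>lborel)
         \<le> (\<integral>x. \<bar>c - q\<bar> * indicator A x + \<bar>q\<bar> * (indicator (W - A) x + indicator (W - V) x) \<partial>lborel)"
      proof (rule integral_mono)
        show "integrable lborel (\<lambda>x. \<bar>indicator A x *\<^sub>R c - val [(r, V)] x\<bar>)"
          using iA intD[of "[(r, V)]"] V by (intro integrable_abs Bochner_Integration.integrable_diff) auto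
        show "integrable lborel (\<lambda>x. \<bar>c - q\<bar> * indicator A x + \<bar>q\<bar> * (indicator (W - A) x + indicator (W - V) x :: real))"
          using iA i1 by auto
        fix x
        \<comment> \<open>On the intersection of \<open>A\<close> and \<open>V\<close> the error is
          |c - q|; on \<open>A - V\<close> it is |c|, at most |c - q| + |q|; on \<open>V - A\<close>
          it is |q|. The last two sets lie in \<open>W - V\<close> and \<open>W - A\<close>.\<close>
        have "V \<subseteq> W" using F by (simp add: V_def)
        then show "\<bar>indicator A x *\<^sub>R c - val [(r, V)] x\<bar> \<le> \<bar>c - q\<bar> * indicator A x + \<bar>q\<bar> * (indicator (W - A) x + indicator (W - V) x)"
          using W(2) by (cases "x \<in> A"; cases "x \<in> V"; cases "x \<in> W") (auto simp: val1)
      qed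
      also have "\<dots> = \<bar>c - q\<bar> * m + \<bar>q\<bar> * (measure lborel (W - A) + measure lborel (W - V))"
        using iA i1 by (simp add: m_def)
      \<comment> \<open>Raising \<open>m\<close> and |q| by 1 makes these factors positive, as the
        strict comparison below requires.\<close>
      also have "\<dots> \<le> \<bar>c - q\<bar> * (m + 1) + (\<bar>q\<bar> + 1) * (measure lborel (W - A) + measure lborel (W - V))"
        using \<open>0 \<le> m\<close> by (intro add_mono mult_mono) auto
      also have "\<dots> < e / (2 * (m + 1)) * (m + 1) + (\<bar>q\<bar> + 1) * (e1 + e1)"
        using r[folded q_def] m1 \<open>0 \<le> m\<close> by (intro add_strict_mono mult_strict_right_mono mult_strict_left_mono) auto
      also have "\<dots> = e"
      proof -
        have "m + 1 \<noteq> 0" using \<open>0 \<le> m\<close> by linarith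
        then have "e / (2 * (m + 1)) * (m + 1) = e / 2" by (simp add: divide_simps)
        moreover have "(\<bar>q\<bar> + 1) * (e1 + e1) = e / 2"
          using \<open>0 < \<bar>q\<bar> + 1\<close> by (simp add: e1_def divide_simps)
        ultimately show ?thesis by simp
      qed
      finally show "\<exists>d\<in>D. (\<integral>x. \<bar>indicator A x *\<^sub>R c - d x\<bar> \<partial>lborel) < e" using d by blast
    qed
  next
    case (add f g)
    show ?case
    proof (intro allI impI)
      fix e :: real assume "0 < e"
      have "0 < e / 2" using \<open>0 < e\<close> by simp
      obtain k where k: "k \<in> lists (UNIV \<times> C)" "(\<integral>x. \<bar>f x - val k x\<bar> \<partial>lborel) < e / 2"
        using add.IH(1)[rule_format, OF \<open>0 < e / 2\<close>] unfolding D_def by blast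
      obtain l where l: "l \<in> lists (UNIV \<times> C)" "(\<integral>x. \<bar>g x - val l x\<bar> \<partial>lborel) < e / 2"
        using add.IH(2)[rule_format, OF \<open>0 < e / 2\<close>] unfolding D_def by blast
      have app: "val (k @ l) x = val k x + val l x" for x by (simp add: val_def)
      have "(\<integral>x. \<bar>f x + g x - val (k @ l) x\<bar> \<partial>lborel) \<le> (\<integral>x. \<bar>f x - val k x\<bar> + \<bar>g x - val l x\<bar> \<partial>lborel)"
        using add intD[OF k(1)] intD[OF l(1)]
        by (intro integral_mono) (auto simp: app)
      also have "\<dots> < e"
        using k l add intD[OF k(1)] intD[OF l(1)] by (subst Bochner_Integration.integral_add) auto
      finally show "\<exists>d\<in>D. (\<integral>x. \<bar>f x + g x - d x\<bar> \<partial>lborel) < e"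
        using k(1) l(1) unfolding D_def by (intro bexI[of _ "val (k @ l)"] imageI) auto
    qed
  next
    case (lim f s)
    show ?case
    proof (intro allI impI)
      fix e :: real assume "0 < e"
      have "(\<lambda>i. \<integral>x. \<bar>f x - s i x\<bar> \<partial>lborel) \<longlonglongrightarrow> 0"
        by (rule tendsto_L1_dominated) (use lim in auto)
      then have "eventually (\<lambda>i. (\<integral>x. \<bar>f x - s i x\<bar> \<partial>lborel) < e / 2) sequentially"
        by (rule order_tendstoD) (use \<open>0 < e\<close> in auto)
      then obtain i where i: "(\<integral>x. \<bar>f x - s i x\<bar> \<partial>lborel) < e / 2" by (auto simp: eventually_sequentially)
      obtain d where d: "d \<in> D" "(\<integral>x. \<bar>s i x - d x\<bar> \<partial>lborel) < e / 2" using lim.IH[of i] half_gt_zero[OF \<open>0 < e\<close>] by blast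
      have di: "integrable lborel d" using d(1) intD by (auto simp: D_def)
      have "(\<integral>x. \<bar>f x - d x\<bar> \<partial>lborel) \<le> (\<integral>x. \<bar>f x - s i x\<bar> + \<bar>s i x - d x\<bar> \<partial>lborel)"
        using lim.hyps di by (intro integral_mono) auto
      also have "\<dots> < e"
        using i d lim.hyps di by (subst Bochner_Integration.integral_add) auto
      finally show "\<exists>d\<in>D. (\<integral>x. \<bar>f x - d x\<bar> \<partial>lborel) < e" using d(1) by blast
    qed
  qed
  show ?thesis using cD intD dense unfolding L1_dense_def D_def by blast
qed

section \<open>Countable subfamilies with the same suprema\<close>

lemma integrable_mult_bounded:
  fixes a f :: "'a \<Rightarrow> real"
  assumes "a \<in> borel_measurable M" "\<And>x. x \<in> space M \<Longrightarrow> \<bar>a x\<bar> \<le> 1" "integrable M f"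
  shows "integrable M (\<lambda>x. a x * f x)"
  by (rule Bochner_Integration.integrable_bound[OF assms(3)])
    (use assms in \<open>auto simp: abs_mult intro!: AE_I2 mult_left_le_one_le\<close>)

text \<open>For weights bounded by 1, the map from \<open>f\<close> to the integral of
  \<open>a x * f x\<close> is 1-Lipschitz in the L1 distance, uniformly in \<open>a\<close>.
  Near-maximisers at the countably many points of \<open>D\<close>, one for each tolerance 1 / (n +
  1), therefore yield near-maximisers at every \<open>f\<close>.\<close>

lemma countable_subfamily_same_bounds:
  fixes G :: "('a \<Rightarrow> real) set"
  assumes D: "countable D" "L1_dense M D"
    and G: "G \<noteq> {}" "\<And>a. a \<in> G \<Longrightarrow> a \<in> borel_measurable M"
      "\<And>a x. a \<in> G \<Longrightarrow> x \<in> space M \<Longrightarrow> \<bar>a x\<bar> \<le> 1"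
  obtains H where "countable H" "H \<noteq> {}" "H \<subseteq> G"
    "\<And>f a e. integrable M f \<Longrightarrow> a \<in> G \<Longrightarrow> 0 < e \<Longrightarrow>
       \<exists>b\<in>H. (\<integral>x. a x * f x \<partial>M) \<le> (\<integral>x. b x * f x \<partial>M) + e"
proof -
  have int: "integrable M (\<lambda>x. a x * f x)" if "a \<in> G" "integrable M f" for a f
    using that G by (intro integrable_mult_bounded) auto
  have lip: "\<bar>(\<integral>x. a x * f x \<partial>M) - (\<integral>x. a x * g x \<partial>M)\<bar> \<le> (\<integral>x. \<bar>f x - g x\<bar> \<partial>M)"
    if "a \<in> G" "integrable M f" "integrable M g" for a f g
  proof -
    have "(\<integral>x. a x * f x \<partial>M) - (\<integral>x. a x * g x \<partial>M) = (\<integral>x. a x * (f x - g x) \<partial>M)"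
      using int[OF that(1,2)] int[OF that(1,3)] by (simp add: right_diff_distrib)
    also have "\<bar>\<dots>\<bar> \<le> (\<integral>x. \<bar>f x - g x\<bar> \<partial>M)"
    proof (rule order_trans[OF integral_abs_bound], rule integral_mono)
      show "integrable M (\<lambda>x. \<bar>a x * (f x - g x)\<bar>)" using int that by auto
      show "integrable M (\<lambda>x. \<bar>f x - g x\<bar>)" using that by auto
      show "\<bar>a x * (f x - g x)\<bar> \<le> \<bar>f x - g x\<bar>" if x: "x \<in> space M" for x
        using G(3)[OF \<open>a \<in> G\<close> x] by (simp add: abs_mult mult_left_le_one_le)
    qed
    finally show ?thesis .
  qed
  \<comment> \<open>\<open>c d n\<close> misses the supremum over \<open>G\<close> at
    \<open>d\<close> by at most 1 / (n + 1); an exact maximiser need not exist.\<close>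
  define c where "c d n = (SOME b. b \<in> G \<and> (\<forall>a\<in>G. (\<integral>x. a x * d x \<partial>M) \<le> (\<integral>x. b x * d x \<partial>M) + 1 / Suc n))" for d n
  have c: "c d n \<in> G \<and> (\<forall>a\<in>G. (\<integral>x. a x * d x \<partial>M) \<le> (\<integral>x. c d n x * d x \<partial>M) + 1 / Suc n)"
    if "d \<in> D" for d n
  proof -
    have d: "integrable M d" using D(2) that by (auto simp: L1_dense_def)
    let ?S = "(\<lambda>a. \<integral>x. a x * d x \<partial>M) ` G"
    have bdd: "bdd_above ?S"
    proof (rule bdd_aboveI2)
      \<comment> \<open>This is the Lipschitz estimate against the zero function.\<close>
      show "(\<integral>x. a x * d x \<partial>M) \<le> (\<integral>x. \<bar>d x - 0\<bar> \<partial>M)" if "a \<in> G" for a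
        using lip[OF that d, of "\<lambda>_. 0"] by auto
    qed
    have "Sup ?S - 1 / Suc n < Sup ?S" by simp
    then obtain b where b: "b \<in> G" "Sup ?S - 1 / Suc n < (\<integral>x. b x * d x \<partial>M)"
      using less_cSup_iff[OF _ bdd] G(1) by auto
    have "\<forall>a\<in>G. (\<integral>x. a x * d x \<partial>M) \<le> (\<integral>x. b x * d x \<partial>M) + 1 / Suc n"
    proof
      fix a assume "a \<in> G"
      then have "(\<integral>x. a x * d x \<partial>M) \<le> Sup ?S" using bdd by (intro cSup_upper) auto
      then show "(\<integral>x. a x * d x \<partial>M) \<le> (\<integral>x. b x * d x \<partial>M) + 1 / Suc n" using b(2) by linarith
    qed
    with b(1) have "\<exists>b. b \<in> G \<and> (\<forall>a\<in>G. (\<integral>x. a x * d x \<partial>M) \<le> (\<integral>x. b x * d x \<partial>M) + 1 / Suc n)"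
      by blast
    then show ?thesis unfolding c_def by (rule someI_ex)
  qed
  \<comment> \<open>The zero function has an approximant in \<open>D\<close>, so \<open>D\<close>,
    and with it the chosen subfamily, is nonempty.\<close>
  have "integrable M (\<lambda>_. 0 :: real)" by simp
  then obtain d0 where "d0 \<in> D" using D(2) zero_less_one unfolding L1_dense_def by blast
  show thesis
  proof (rule that[of "(\<lambda>(d, n). c d n) ` (D \<times> UNIV)"])
    show "countable ((\<lambda>(d, n). c d n) ` (D \<times> UNIV))" using D(1) by auto
    show "(\<lambda>(d, n). c d n) ` (D \<times> UNIV) \<noteq> {}" using \<open>d0 \<in> D\<close> by auto
    show "(\<lambda>(d, n). c d n) ` (D \<times> UNIV) \<subseteq> G" using c by auto
    fix f a :: "'a \<Rightarrow> real" and e :: real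
    assume f: "integrable M f" and a: "a \<in> G" and e: "0 < e"
    \<comment> \<open>Three errors of at most \<open>e / 3\<close>: from \<open>a\<close> at
      \<open>f\<close> to \<open>a\<close> at \<open>d\<close>, then to \<open>c d n\<close> at
      \<open>d\<close>, then back to \<open>f\<close>.\<close>
    have "0 < e / 3" using e by simp
    then obtain d where d: "d \<in> D" "(\<integral>x. \<bar>f x - d x\<bar> \<partial>M) < e / 3"
      using D(2) f unfolding L1_dense_def by blast
    have di: "integrable M d" using D(2) d(1) by (auto simp: L1_dense_def)
    obtain n where n: "1 / Suc n < e / 3" using nat_approx_posE[of "e / 3"] e by auto
    have "(\<integral>x. a x * f x \<partial>M) \<le> (\<integral>x. c d n x * f x \<partial>M) + e"
      using lip[OF a f di] lip[OF _ f di, of "c d n"] c[OF d(1), of n] bspec[OF conjunct2[OF c[OF d(1), of n]] a] n d(2)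
      by linarith
    then show "\<exists>b\<in>(\<lambda>(d, n). c d n) ` (D \<times> UNIV). (\<integral>x. a x * f x \<partial>M) \<le> (\<integral>x. b x * f x \<partial>M) + e"
      using d(1) by (intro bexI[of _ "c d n"]) auto
  qed
qed

subsection \<open>One step of the recursion\<close>

text \<open>No index need attain the supremum, but the largest of finitely many values can be
  selected measurably, and these running maxima increase to the supremum. Monotone convergence gives
  the inequality from left to right; the other one is pointwise.\<close>

lemma nn_integral_SUP_measurable_selection:
  fixes F :: "nat \<Rightarrow> 'a \<Rightarrow> ennreal"
  assumes [measurable]: "\<And>n. F n \<in> borel_measurable M"
  shows "(\<integral>\<^sup>+x. (SUP n. F n x) \<partial>M) = (SUP s\<in>measurable M (count_space UNIV). \<integral>\<^sup>+x. F (s x) x \<partial>M)"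
proof (rule antisym)
  \<comment> \<open>\<open>s n x\<close> is the first index at which \<open>F 0 x\<close>, ...,
    \<open>F n x\<close> reach their maximum; the strict comparison keeps the earlier index at
    ties.\<close>
  define s where "s = rec_nat (\<lambda>_. 0) (\<lambda>n s x. if F (s x) x < F (Suc n) x then Suc n else s x)"
  have s_0: "s 0 = (\<lambda>_. 0)" and s_Suc: "s (Suc n) = (\<lambda>x. if F (s n x) x < F (Suc n) x then Suc n else s n x)" for n
    unfolding s_def by simp_all
  have s_meas [measurable]: "s n \<in> measurable M (count_space UNIV)" for n
    by (induction n) (simp_all add: s_0 s_Suc)
  have inc: "F (s n x) x \<le> F (s (Suc n) x) x" for n x by (auto simp: s_Suc)
  have ge: "F n x \<le> F (s n x) x" for n x by (cases n) (auto simp: s_0 s_Suc)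
  have SUP_eq: "(SUP n. F n x) = (SUP n. F (s n x) x)" for x
  proof (rule antisym)
    show "(SUP n. F n x) \<le> (SUP n. F (s n x) x)" using ge by (intro SUP_mono) auto
    show "(SUP n. F (s n x) x) \<le> (SUP n. F n x)" by (intro SUP_least SUP_upper) auto
  qed
  have "(\<integral>\<^sup>+x. (SUP n. F n x) \<partial>M) = (SUP n. \<integral>\<^sup>+x. F (s n x) x \<partial>M)"
    unfolding SUP_eq
    by (rule nn_integral_monotone_convergence_SUP) (auto simp: incseq_Suc_iff le_fun_def inc)
  also have "\<dots> \<le> (SUP s\<in>measurable M (count_space UNIV). \<integral>\<^sup>+x. F (s x) x \<partial>M)"
    using s_meas by (intro SUP_mono) auto
  finally show "(\<integral>\<^sup>+x. (SUP n. F n x) \<partial>M) \<le> (SUP s\<in>measurable M (count_space UNIV). \<integral>\<^sup>+x. F (s x) x \<partial>M)" .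
  show "(SUP s\<in>measurable M (count_space UNIV). \<integral>\<^sup>+x. F (s x) x \<partial>M) \<le> (\<integral>\<^sup>+x. (SUP n. F n x) \<partial>M)"
    by (intro SUP_least nn_integral_mono SUP_upper) auto
qed

text \<open>By Tonelli, the inner integral becomes the mass of the kernel out of \<open>s\<close>; a
  kernel of mass at most 1 cannot increase total mass.\<close>

lemma nn_integral_kernel_le:
  assumes "sigma_finite_measure M"
    and [measurable]: "case_prod P \<in> borel_measurable (M \<Otimes>\<^sub>M M)" "f \<in> borel_measurable M"
    and mass: "\<And>s. s \<in> space M \<Longrightarrow> (\<integral>\<^sup>+s'. P s' s \<partial>M) \<le> 1"
  shows "(\<integral>\<^sup>+s'. \<integral>\<^sup>+s. P s' s * f s \<partial>M \<partial>M) \<le> (\<integral>\<^sup>+s. f s \<partial>M)"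
proof -
  interpret M: sigma_finite_measure M by fact
  interpret MM: pair_sigma_finite M M ..
  have "(\<integral>\<^sup>+s'. \<integral>\<^sup>+s. P s' s * f s \<partial>M \<partial>M) = (\<integral>\<^sup>+s. \<integral>\<^sup>+s'. P s' s * f s \<partial>M \<partial>M)"
    by (rule MM.Fubini'[symmetric]) measurable
  also have "\<dots> = (\<integral>\<^sup>+s. (\<integral>\<^sup>+s'. P s' s \<partial>M) * f s \<partial>M)"
    by (intro nn_integral_cong) (simp add: nn_integral_multc)
  also have "\<dots> \<le> (\<integral>\<^sup>+s. 1 * f s \<partial>M)"
    by (intro nn_integral_mono mult_right_mono mass) auto
  finally show ?thesis by simp
qed

section \<open>Statistics and weights on the safe set\<close>

definition safe_statistic :: "'s measure \<Rightarrow> 's set \<Rightarrow> ('s \<Rightarrow> real) \<Rightarrow> bool" where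
  "safe_statistic M K \<sigma> \<longleftrightarrow> integrable M (\<lambda>s. indicator K s * \<sigma> s) \<and> (\<forall>s\<in>K. 0 \<le> \<sigma> s)"

text \<open>\<open>L\<close> is the likelihood of an observation relative to \<open>R\<close>, and
  \<open>P\<close> the transition density out of safe states. The update is tied to them almost
  everywhere only, since a Bochner integral defaults to 0 where the extended integral diverges; one
  null set of states serves all observations.\<close>

locale safe_filter = M: sigma_finite_measure M + R: sigma_finite_measure R
  for M :: "'s measure" and R :: "'y measure" +
  fixes K :: "'s set" and U :: "'u set"
    and \<Phi> :: "'y \<Rightarrow> 'u \<Rightarrow> ('s \<Rightarrow> real) \<Rightarrow> 's \<Rightarrow> real"
    and L :: "'u \<Rightarrow> 'y \<Rightarrow> 's \<Rightarrow> ennreal"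
    and P :: "'u \<Rightarrow> 's \<Rightarrow> 's \<Rightarrow> ennreal"
  assumes K_sets [measurable]: "K \<in> sets M"
    and U_ne: "U \<noteq> {}"
    and L1_separable: "\<exists>D. countable D \<and> L1_dense M D"
    and P_measurable: "u \<in> U \<Longrightarrow> case_prod (P u) \<in> borel_measurable (M \<Otimes>\<^sub>M M)"
    and P_mass: "u \<in> U \<Longrightarrow> s \<in> space M \<Longrightarrow> (\<integral>\<^sup>+s'. P u s' s \<partial>M) \<le> indicator K s"
    and L_measurable: "u \<in> U \<Longrightarrow> case_prod (L u) \<in> borel_measurable (R \<Otimes>\<^sub>M M)"
    and L_mass: "u \<in> U \<Longrightarrow> s \<in> space M \<Longrightarrow> (\<integral>\<^sup>+y. L u y s \<partial>R) \<le> 1"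
    and update_measurable: "safe_statistic M K \<sigma> \<Longrightarrow>
      u \<in> U \<Longrightarrow> y \<in> space R \<Longrightarrow> (\<lambda>s. indicator K s * \<Phi> y u \<sigma> s) \<in> borel_measurable M"
    and update_nonneg: "safe_statistic M K \<sigma> \<Longrightarrow>
      u \<in> U \<Longrightarrow> y \<in> space R \<Longrightarrow> s \<in> K \<Longrightarrow> 0 \<le> \<Phi> y u \<sigma> s"
    and update_eq: "safe_statistic M K \<sigma> \<Longrightarrow>
      u \<in> U \<Longrightarrow> AE s' in M. \<forall>y\<in>space R. ennreal (indicator K s' * \<Phi> y u \<sigma> s') =
        L u y s' * (\<integral>\<^sup>+s. P u s' s * ennreal (indicator K s * \<sigma> s) \<partial>M)"
begin

definition safe_weights :: "('s \<Rightarrow> real) set" where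
  "safe_weights = {a \<in> borel_measurable M. \<forall>s. 0 \<le> a s \<and> a s \<le> indicator K s}"

text \<open>Nonemptiness allows a countable family to be enumerated as a sequence, and its supremum
  to be read in the reals later.\<close>

definition represents :: "('s \<Rightarrow> real) set \<Rightarrow> (('s \<Rightarrow> real) \<Rightarrow> ennreal) \<Rightarrow> bool" where
  "represents \<Gamma> V \<longleftrightarrow> \<Gamma> \<noteq> {} \<and> \<Gamma> \<subseteq> safe_weights \<and>
     (\<forall>\<sigma>. safe_statistic M K \<sigma> \<longrightarrow> V \<sigma> = (SUP a\<in>\<Gamma>. \<integral>\<^sup>+s. ennreal (a s * \<sigma> s) \<partial>M))"

lemma safe_weightsD:
  assumes "a \<in> safe_weights"
  shows "a \<in> borel_measurable M" "0 \<le> a s" "a s \<le> indicator K s" "a s \<le> 1" "s \<notin> K \<Longrightarrow> a s = 0"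
proof -
  show "a \<in> borel_measurable M" and 0: "0 \<le> a s" and 1: "a s \<le> indicator K s"
    using assms by (auto simp: safe_weights_def)
  show "a s \<le> 1" using 1 indicator_le_1 by (rule order_trans)
  show "a s = 0" if "s \<notin> K" using 0 1 that by simp
qed

lemma safe_weight_mult:
  assumes "a \<in> safe_weights"
  shows "a s * \<sigma> s = a s * (indicator K s * \<sigma> s)"
  using safe_weightsD(5)[OF assms, of s] by (auto simp: indicator_def)

lemma safe_weight_integrable:
  assumes "a \<in> safe_weights" "safe_statistic M K \<sigma>"
  shows "integrable M (\<lambda>s. a s * \<sigma> s)"
  unfolding safe_weight_mult[OF assms(1), of _ \<sigma>]
  by (rule integrable_mult_bounded) (use assms safe_weightsD in \<open>auto simp: safe_statistic_def\<close>)

lemma safe_weight_nonneg: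
  assumes "a \<in> safe_weights" "safe_statistic M K \<sigma>"
  shows "0 \<le> a s * \<sigma> s"
  using assms safe_weightsD(2,5)[OF assms(1), of s] by (cases "s \<in> K") (auto simp: safe_statistic_def)

lemma safe_weight_nn_integral:
  assumes "a \<in> safe_weights" "safe_statistic M K \<sigma>"
  shows "(\<integral>\<^sup>+s. ennreal (a s * \<sigma> s) \<partial>M) = ennreal (\<integral>s. a s * \<sigma> s \<partial>M)"
  by (intro nn_integral_eq_integral safe_weight_integrable AE_I2 safe_weight_nonneg assms)

text \<open>Weights are bounded by 1, so by L1 separability one countable subfamily contains
  near-maximisers against \<open>indicator K s * \<sigma> s\<close> for every \<sigma> at once.
  Countability is what the measurable selection of an index relies on.\<close>

lemma represents_countable:
  assumes "represents \<Gamma> V"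
  obtains \<Delta> where "countable \<Delta>" "represents \<Delta> V"
proof -
  obtain D where D: "countable D" "L1_dense M D" using L1_separable by blast
  have G: "\<Gamma> \<noteq> {}" "\<Gamma> \<subseteq> safe_weights"
    and V: "\<And>\<sigma>. safe_statistic M K \<sigma> \<Longrightarrow> V \<sigma> = (SUP a\<in>\<Gamma>. \<integral>\<^sup>+s. ennreal (a s * \<sigma> s) \<partial>M)"
    using assms by (auto simp: represents_def)
  obtain \<Delta> where \<Delta>: "countable \<Delta>" "\<Delta> \<noteq> {}" "\<Delta> \<subseteq> \<Gamma>"
    and approx: "\<And>f a e. integrable M f \<Longrightarrow> a \<in> \<Gamma> \<Longrightarrow> 0 < e \<Longrightarrow>
       \<exists>b\<in>\<Delta>. (\<integral>x. a x * f x \<partial>M) \<le> (\<integral>x. b x * f x \<partial>M) + e"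
  proof (rule countable_subfamily_same_bounds[OF D G(1)])
    show "a \<in> borel_measurable M" if "a \<in> \<Gamma>" for a using that G(2) safe_weightsD(1) by blast
    show "\<bar>a x\<bar> \<le> 1" if "a \<in> \<Gamma>" for a x
      using that G(2) safe_weightsD(2,4)[of a x] by auto
  qed (rule that; blast)
  have "V \<sigma> = (SUP a\<in>\<Delta>. \<integral>\<^sup>+s. ennreal (a s * \<sigma> s) \<partial>M)" if \<sigma>: "safe_statistic M K \<sigma>" for \<sigma>
    unfolding V[OF \<sigma>]
  proof (rule antisym)
    show "(SUP a\<in>\<Delta>. \<integral>\<^sup>+s. ennreal (a s * \<sigma> s) \<partial>M) \<le> (SUP a\<in>\<Gamma>. \<integral>\<^sup>+s. ennreal (a s * \<sigma> s) \<partial>M)"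
      using \<Delta>(3) by (rule SUP_subset_mono) simp
    show "(SUP a\<in>\<Gamma>. \<integral>\<^sup>+s. ennreal (a s * \<sigma> s) \<partial>M) \<le> (SUP a\<in>\<Delta>. \<integral>\<^sup>+s. ennreal (a s * \<sigma> s) \<partial>M)"
    proof (rule SUP_least, rule ennreal_le_epsilon)
      fix a and e :: real assume a: "a \<in> \<Gamma>" and e: "0 < e"
      obtain b where b: "b \<in> \<Delta>"
        "(\<integral>s. a s * (indicator K s * \<sigma> s) \<partial>M) \<le> (\<integral>s. b s * (indicator K s * \<sigma> s) \<partial>M) + e"
        using approx[OF _ a e, of "\<lambda>s. indicator K s * \<sigma> s"] \<sigma> by (auto simp: safe_statistic_def)
      have w: "a \<in> safe_weights" "b \<in> safe_weights" using a b(1) \<Delta>(3) G(2) by auto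
      have "(\<integral>\<^sup>+s. ennreal (a s * \<sigma> s) \<partial>M) = ennreal (\<integral>s. a s * \<sigma> s \<partial>M)"
        using w \<sigma> by (simp add: safe_weight_nn_integral)
      also have "\<dots> \<le> ennreal ((\<integral>s. b s * \<sigma> s \<partial>M) + e)"
        using b(2) by (intro ennreal_leI) (simp add: safe_weight_mult[symmetric] w)
      also have "\<dots> = (\<integral>\<^sup>+s. ennreal (b s * \<sigma> s) \<partial>M) + ennreal e"
        using w \<sigma> e by (simp add: safe_weight_nn_integral safe_weight_nonneg ennreal_plus)
      also have "\<dots> \<le> (SUP a\<in>\<Delta>. \<integral>\<^sup>+s. ennreal (a s * \<sigma> s) \<partial>M) + ennreal e"
        using b(1) by (intro add_right_mono SUP_upper)
      finally show "(\<integral>\<^sup>+s. ennreal (a s * \<sigma> s) \<partial>M) \<le> (SUP a\<in>\<Delta>. \<integral>\<^sup>+s. ennreal (a s * \<sigma> s) \<partial>M) + ennreal e" .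
    qed
  qed
  then show thesis using that[of \<Delta>] \<Delta> G by (auto simp: represents_def)
qed

text \<open>In filter terms: the expected value at the successor state of the weight that
  \<open>c\<close> selects from the observation, given state \<open>s\<close> and control
  \<open>u\<close>. The integral is at most 1 on the space, so \<open>enn2real\<close> loses nothing
  there; the leading indicator secures the bounds of \<open>safe_weights\<close> outside the space
  as well.\<close>

definition backup :: "'u \<Rightarrow> (nat \<Rightarrow> 's \<Rightarrow> real) \<Rightarrow> ('y \<Rightarrow> nat) \<Rightarrow> 's \<Rightarrow> real" where
  "backup u a c s = indicator (space M) s * enn2real (\<integral>\<^sup>+s'. (\<integral>\<^sup>+y. ennreal (a (c y) s') * L u y s' \<partial>R) * P u s' s \<partial>M)"

context
  fixes u :: 'u and a :: "nat \<Rightarrow> 's \<Rightarrow> real" and c :: "'y \<Rightarrow> nat"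
  assumes u: "u \<in> U" and a: "\<And>n. a n \<in> safe_weights" and c [measurable]: "c \<in> measurable R (count_space UNIV)"
begin

lemmas [measurable] = P_measurable[OF u] L_measurable[OF u] safe_weightsD(1)[OF a]

text \<open>The level sets of \<open>c\<close> are countably many measurable sets, and on each of
  them the index is constant.\<close>

lemma selected_weight_measurable [measurable]:
  "(\<lambda>(y, s). a (c y) s) \<in> borel_measurable (R \<Otimes>\<^sub>M M)"
  unfolding case_prod_beta
  by (rule measurable_compose_countable[where f="\<lambda>n x. a n (snd x)" and g="\<lambda>x. c (fst x)"]) measurable

lemma averaged_weight_le_1:
  assumes "s' \<in> space M"
  shows "(\<integral>\<^sup>+y. ennreal (a (c y) s') * L u y s' \<partial>R) \<le> 1"
proof -
  have "(\<integral>\<^sup>+y. ennreal (a (c y) s') * L u y s' \<partial>R) \<le> (\<integral>\<^sup>+y. L u y s' \<partial>R)"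
    using mult_right_mono[of "ennreal (a (c y) s')" 1 "L u y s'" for y] safe_weightsD(4)[OF a]
    by (intro nn_integral_mono) simp
  then show ?thesis using L_mass[OF u assms] by (rule order_trans)
qed

lemma backup_bound:
  assumes "s \<in> space M"
  shows "(\<integral>\<^sup>+s'. (\<integral>\<^sup>+y. ennreal (a (c y) s') * L u y s' \<partial>R) * P u s' s \<partial>M) \<le> indicator K s"
proof -
  have "(\<integral>\<^sup>+s'. (\<integral>\<^sup>+y. ennreal (a (c y) s') * L u y s' \<partial>R) * P u s' s \<partial>M) \<le> (\<integral>\<^sup>+s'. 1 * P u s' s \<partial>M)"
    by (intro nn_integral_mono mult_right_mono averaged_weight_le_1) auto
  then show ?thesis using P_mass[OF u assms] by simp
qed

lemma ennreal_backup:
  assumes "s \<in> space M"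
  shows "ennreal (backup u a c s) = (\<integral>\<^sup>+s'. (\<integral>\<^sup>+y. ennreal (a (c y) s') * L u y s' \<partial>R) * P u s' s \<partial>M)"
proof -
  have "(\<integral>\<^sup>+s'. (\<integral>\<^sup>+y. ennreal (a (c y) s') * L u y s' \<partial>R) * P u s' s \<partial>M) \<le> 1"
    using backup_bound[OF assms] by (rule order_trans) (simp add: indicator_def)
  then have "(\<integral>\<^sup>+s'. (\<integral>\<^sup>+y. ennreal (a (c y) s') * L u y s' \<partial>R) * P u s' s \<partial>M) < top"
    using ennreal_one_less_top by (rule le_less_trans)
  then show ?thesis using assms by (simp add: backup_def)
qed

lemma backup_safe_weights: "backup u a c \<in> safe_weights"
  unfolding safe_weights_def
proof (safe)
  show "backup u a c \<in> borel_measurable M"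
    unfolding backup_def[abs_def] by measurable
  show "0 \<le> backup u a c s" for s by (simp add: backup_def)
  show "backup u a c s \<le> indicator K s" for s
  proof (cases "s \<in> space M")
    case True
    then have "ennreal (backup u a c s) \<le> ennreal (indicator K s)"
      using backup_bound[OF True] ennreal_backup[OF True] by (simp add: ennreal_indicator)
    then show ?thesis by (subst (asm) ennreal_le_iff) auto
  qed (simp add: backup_def)
qed

text \<open>Tonelli, applied first to \<open>y\<close> and \<open>s'\<close> and then to
  \<open>s'\<close> and \<open>s\<close>, moves the update from the statistic to the weight. All
  integrands are nonnegative, so no integrability has to be checked.\<close>

lemma backup_adjoint:
  assumes \<sigma>: "safe_statistic M K \<sigma>"
  shows "(\<integral>\<^sup>+y. \<integral>\<^sup>+s'. ennreal (a (c y) s') *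
            (L u y s' * (\<integral>\<^sup>+s. P u s' s * ennreal (indicator K s * \<sigma> s) \<partial>M)) \<partial>M \<partial>R)
    = (\<integral>\<^sup>+s. ennreal (backup u a c s * \<sigma> s) \<partial>M)"
proof -
  interpret RM: pair_sigma_finite R M ..
  interpret MM: pair_sigma_finite M M ..
  define \<tau> where "\<tau> s = ennreal (indicator K s * \<sigma> s)" for s
  have [measurable]: "\<tau> \<in> borel_measurable M"
    using \<sigma> unfolding \<tau>_def[abs_def] safe_statistic_def by (auto intro: borel_measurable_integrable)
  let ?w = "\<lambda>s'. \<integral>\<^sup>+y. ennreal (a (c y) s') * L u y s' \<partial>R"
  have "(\<integral>\<^sup>+y. \<integral>\<^sup>+s'. ennreal (a (c y) s') * (L u y s' * (\<integral>\<^sup>+s. P u s' s * \<tau> s \<partial>M)) \<partial>M \<partial>R)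
    = (\<integral>\<^sup>+s'. \<integral>\<^sup>+y. ennreal (a (c y) s') * (L u y s' * (\<integral>\<^sup>+s. P u s' s * \<tau> s \<partial>M)) \<partial>R \<partial>M)"
    by (rule RM.Fubini'[symmetric]) measurable
  also have "\<dots> = (\<integral>\<^sup>+s'. ?w s' * (\<integral>\<^sup>+s. P u s' s * \<tau> s \<partial>M) \<partial>M)"
    by (intro nn_integral_cong) (simp add: mult.assoc[symmetric] nn_integral_multc)
  also have "\<dots> = (\<integral>\<^sup>+s'. \<integral>\<^sup>+s. ?w s' * P u s' s * \<tau> s \<partial>M \<partial>M)"
    by (intro nn_integral_cong) (simp add: mult.assoc nn_integral_cmult)
  also have "\<dots> = (\<integral>\<^sup>+s. \<integral>\<^sup>+s'. ?w s' * P u s' s * \<tau> s \<partial>M \<partial>M)"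
    by (rule MM.Fubini'[symmetric]) measurable
  also have "\<dots> = (\<integral>\<^sup>+s. (\<integral>\<^sup>+s'. ?w s' * P u s' s \<partial>M) * \<tau> s \<partial>M)"
    by (intro nn_integral_cong) (simp add: nn_integral_multc)
  also have "\<dots> = (\<integral>\<^sup>+s. ennreal (backup u a c s) * \<tau> s \<partial>M)"
    by (intro nn_integral_cong) (simp add: ennreal_backup)
  also have "\<dots> = (\<integral>\<^sup>+s. ennreal (backup u a c s * \<sigma> s) \<partial>M)"
    using backup_safe_weights
    by (intro nn_integral_cong) (simp add: \<tau>_def safe_weight_mult[of _ _ \<sigma>] safe_weightsD ennreal_mult')
  finally show ?thesis by (simp add: \<tau>_def)
qed

end

text \<open>Integrated over \<open>y\<close>, the mass of the updated statistic is at most the mass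
  of \<sigma> on \<open>K\<close>. It is therefore finite for almost every observation.\<close>

lemma updated_statistic:
  assumes \<sigma>: "safe_statistic M K \<sigma>" and u: "u \<in> U"
  shows "AE y in R. safe_statistic M K (\<Phi> y u \<sigma>)"
proof -
  interpret RM: pair_sigma_finite R M ..
  note [measurable] = P_measurable[OF u] L_measurable[OF u]
  have \<sigma>': "integrable M (\<lambda>s. indicator K s * \<sigma> s)" "\<And>s. s \<in> K \<Longrightarrow> 0 \<le> \<sigma> s"
    using \<sigma> by (auto simp: safe_statistic_def)
  define \<tau> where "\<tau> s = ennreal (indicator K s * \<sigma> s)" for s
  have [measurable]: "\<tau> \<in> borel_measurable M"
    using \<sigma> unfolding \<tau>_def[abs_def] safe_statistic_def by (auto intro: borel_measurable_integrable)
  have "(\<integral>\<^sup>+y. \<integral>\<^sup>+s'. L u y s' * (\<integral>\<^sup>+s. P u s' s * \<tau> s \<partial>M) \<partial>M \<partial>R)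
    = (\<integral>\<^sup>+s'. \<integral>\<^sup>+y. L u y s' * (\<integral>\<^sup>+s. P u s' s * \<tau> s \<partial>M) \<partial>R \<partial>M)"
    by (rule RM.Fubini'[symmetric]) measurable
  also have "\<dots> = (\<integral>\<^sup>+s'. (\<integral>\<^sup>+y. L u y s' \<partial>R) * (\<integral>\<^sup>+s. P u s' s * \<tau> s \<partial>M) \<partial>M)"
    by (intro nn_integral_cong) (simp add: nn_integral_multc)
  also have "\<dots> \<le> (\<integral>\<^sup>+s'. 1 * (\<integral>\<^sup>+s. P u s' s * \<tau> s \<partial>M) \<partial>M)"
    using L_mass[OF u] by (intro nn_integral_mono mult_right_mono) auto
  also have "\<dots> \<le> (\<integral>\<^sup>+s. \<tau> s \<partial>M)"
    unfolding mult_1_left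
    by (intro nn_integral_kernel_le M.sigma_finite_measure_axioms order_trans[OF P_mass[OF u]])
      (auto simp: indicator_def)
  also have "\<dots> < \<infinity>"
    using \<sigma>' by (simp add: \<tau>_def integrable_iff_bounded indicator_def abs_of_nonneg cong: if_cong)
  finally have "AE y in R. (\<integral>\<^sup>+s'. L u y s' * (\<integral>\<^sup>+s. P u s' s * \<tau> s \<partial>M) \<partial>M) \<noteq> \<infinity>"
    by (intro nn_integral_PInf_AE) auto
  with AE_space show ?thesis
  proof eventually_elim
    case (elim y)
    have "(\<integral>\<^sup>+s'. ennreal (indicator K s' * \<Phi> y u \<sigma> s') \<partial>M) = (\<integral>\<^sup>+s'. L u y s' * (\<integral>\<^sup>+s. P u s' s * \<tau> s \<partial>M) \<partial>M)"
      using update_eq[OF \<sigma> u] elim(1) unfolding \<tau>_def by (intro nn_integral_cong_AE) auto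
    moreover have nn: "0 \<le> indicator K s * \<Phi> y u \<sigma> s" for s
      using update_nonneg[OF \<sigma> u elim(1)] by (auto simp: indicator_def)
    ultimately have "integrable M (\<lambda>s. indicator K s * \<Phi> y u \<sigma> s)"
      using elim(2) update_measurable[OF \<sigma> u elim(1)]
      by (auto simp: integrable_iff_bounded less_top abs_of_nonneg[OF nn])
    then show ?case
      using update_nonneg[OF \<sigma> u elim(1)] by (auto simp: safe_statistic_def)
  qed
qed

text \<open>The new family consists of the backups for all controls and all measurable selectors. It
  may be uncountable; \<open>represents_countable\<close> thins it out before it is used
  again.\<close>

lemma represents_backup:
  assumes "represents \<Gamma> V"
  shows "\<exists>\<Delta>. represents \<Delta> (\<lambda>\<sigma>. SUP u\<in>U. \<integral>\<^sup>+y. V (\<Phi> y u \<sigma>) \<partial>R)"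
proof -
  obtain G where "countable G" and G: "represents G V" using represents_countable[OF assms] by blast
  define a where "a = from_nat_into G"
  have ran: "range a = G" using \<open>countable G\<close> G by (simp add: a_def range_from_nat_into represents_def)
  have a: "a n \<in> safe_weights" for n using ran G by (auto simp: represents_def)
  note [measurable] = safe_weightsD(1)[OF a]
  let ?\<Delta> = "(\<lambda>(u, c). backup u a c) ` (U \<times> measurable R (count_space UNIV))"
  have "(SUP u\<in>U. \<integral>\<^sup>+y. V (\<Phi> y u \<sigma>) \<partial>R) = (SUP b\<in>?\<Delta>. \<integral>\<^sup>+s. ennreal (b s * \<sigma> s) \<partial>M)"
    if \<sigma>: "safe_statistic M K \<sigma>" for \<sigma>
  proof -
    have \<sigma>': "integrable M (\<lambda>s. indicator K s * \<sigma> s)" "\<And>s. s \<in> K \<Longrightarrow> 0 \<le> \<sigma> s"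
      using \<sigma> by (auto simp: safe_statistic_def)
    have [measurable]: "(\<lambda>s. indicator K s * \<sigma> s) \<in> borel_measurable M" using \<sigma>' by auto
    have "(\<integral>\<^sup>+y. V (\<Phi> y u \<sigma>) \<partial>R) =
      (SUP c\<in>measurable R (count_space UNIV). \<integral>\<^sup>+s. ennreal (backup u a c s * \<sigma> s) \<partial>M)" if u: "u \<in> U" for u
    proof -
      note [measurable] = P_measurable[OF u] L_measurable[OF u]
      define F where "F n y = (\<integral>\<^sup>+s'. ennreal (a n s') *
            (L u y s' * (\<integral>\<^sup>+s. P u s' s * ennreal (indicator K s * \<sigma> s) \<partial>M)) \<partial>M)" for n y
      have "(\<integral>\<^sup>+y. V (\<Phi> y u \<sigma>) \<partial>R) = (\<integral>\<^sup>+y. (SUP n. F n y) \<partial>R)"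
      proof (rule nn_integral_cong_AE)
        show "AE y in R. V (\<Phi> y u \<sigma>) = (SUP n. F n y)"
          using updated_statistic[OF \<sigma> u] AE_space
        proof eventually_elim
          case (elim y)
          have "(\<integral>\<^sup>+s. ennreal (a n s * \<Phi> y u \<sigma> s) \<partial>M) = F n y" for n
            unfolding F_def
          proof (rule nn_integral_cong_AE)
            \<comment> \<open>\<open>a n\<close> vanishes off \<open>K\<close>, so the updated
              statistic may be cut down to \<open>K\<close>, where \<open>update_eq\<close>
              describes it.\<close>
            show "AE s in M. ennreal (a n s * \<Phi> y u \<sigma> s) = ennreal (a n s) *
               (L u y s * (\<integral>\<^sup>+r. P u s r * ennreal (indicator K r * \<sigma> r) \<partial>M))"
              using update_eq[OF \<sigma> u]
              by eventually_elim
                (use elim(2) in \<open>auto simp: safe_weight_mult[OF a, of _ _ "\<Phi> y u \<sigma>"] ennreal_mult' safe_weightsD(2)[OF a]\<close>)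
          qed
          then show ?case using G elim(1) unfolding represents_def ran[symmetric] by (simp add: image_image)
        qed
      qed
      \<comment> \<open>Choosing the best index after seeing \<open>y\<close> is replaced by
        choosing a selector in advance.\<close>
      also have "\<dots> = (SUP c\<in>measurable R (count_space UNIV). \<integral>\<^sup>+y. F (c y) y \<partial>R)"
        by (rule nn_integral_SUP_measurable_selection) (unfold F_def, measurable)
      also have "\<dots> = (SUP c\<in>measurable R (count_space UNIV). \<integral>\<^sup>+s. ennreal (backup u a c s * \<sigma> s) \<partial>M)"
        unfolding F_def by (intro SUP_cong refl backup_adjoint u a \<sigma>)
      finally show ?thesis .
    qed
    then have "(SUP u\<in>U. \<integral>\<^sup>+y. V (\<Phi> y u \<sigma>) \<partial>R) =
        (SUP u\<in>U. SUP c\<in>measurable R (count_space UNIV). \<integral>\<^sup>+s. ennreal (backup u a c s * \<sigma> s) \<partial>M)"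
      by (intro SUP_cong refl)
    also have "\<dots> = (SUP b\<in>?\<Delta>. \<integral>\<^sup>+s. ennreal (b s * \<sigma> s) \<partial>M)"
    proof (rule antisym)
      show "(SUP u\<in>U. SUP c\<in>measurable R (count_space UNIV). \<integral>\<^sup>+s. ennreal (backup u a c s * \<sigma> s) \<partial>M) \<le>
          (SUP b\<in>?\<Delta>. \<integral>\<^sup>+s. ennreal (b s * \<sigma> s) \<partial>M)"
        by (intro SUP_least SUP_upper2[OF _ order_refl] image_eqI[of _ _ "(_, _)"]) auto
      show "(SUP b\<in>?\<Delta>. \<integral>\<^sup>+s. ennreal (b s * \<sigma> s) \<partial>M) \<le>
          (SUP u\<in>U. SUP c\<in>measurable R (count_space UNIV). \<integral>\<^sup>+s. ennreal (backup u a c s * \<sigma> s) \<partial>M)"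
        by (rule SUP_least, clarsimp, rule SUP_upper2, assumption, rule SUP_upper2) auto
    qed
    finally show ?thesis .
  qed
  moreover have "?\<Delta> \<noteq> {}"
  proof -
    have "(\<lambda>_. 0 :: nat) \<in> measurable R (count_space UNIV)" by simp
    then show ?thesis using U_ne by blast
  qed
  moreover have "?\<Delta> \<subseteq> safe_weights" using backup_safe_weights a by auto
  ultimately have "represents ?\<Delta> (\<lambda>\<sigma>. SUP u\<in>U. \<integral>\<^sup>+y. V (\<Phi> y u \<sigma>) \<partial>R)" by (auto simp: represents_def)
  then show ?thesis by blast
qed

end

subsection \<open>Product with a finite counting measure\<close>

lemma measurable_pair_count_space:
  assumes "\<And>q :: 'q::countable. (\<lambda>x. f (x, q)) \<in> measurable M N"
  shows "f \<in> measurable (M \<Otimes>\<^sub>M count_space UNIV) N"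
proof -
  have "(\<lambda>z. f (fst z, snd z)) \<in> measurable (M \<Otimes>\<^sub>M count_space UNIV) N"
    by (rule measurable_compose_countable[where f="\<lambda>q z. f (fst z, q)" and g=snd])
      (use assms in measurable)
  then show ?thesis by simp
qed

text \<open>The discrete coordinates are frozen one after the other. Each has countably many values,
  so the pieces glue, and joint measurability is left to check in the other two coordinates.\<close>

lemma measurable_pair_pair_count_space:
  fixes f :: "'a \<times> 'p::countable \<Rightarrow> 'b \<times> 'q::countable \<Rightarrow> 'c"
  assumes "\<And>p q. (\<lambda>(x, y). f (x, p) (y, q)) \<in> measurable (M \<Otimes>\<^sub>M N) L"
  shows "case_prod f \<in> measurable ((M \<Otimes>\<^sub>M count_space UNIV) \<Otimes>\<^sub>M (N \<Otimes>\<^sub>M count_space UNIV)) L"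
    (is "_ \<in> measurable ?MN L")
proof -
  have "(\<lambda>z. f (fst (fst z), p) (fst (snd z), q)) \<in> measurable ?MN L" for p q
  proof -
    have "(\<lambda>z. (fst (fst z), fst (snd z))) \<in> measurable ?MN (M \<Otimes>\<^sub>M N)" by measurable
    from measurable_compose[OF this assms[of p q]] show ?thesis by simp
  qed
  then have "(\<lambda>z. f (fst (fst z), p) (fst (snd z), snd (snd z))) \<in> measurable ?MN L" for p
    by (rule measurable_compose_countable[where f="\<lambda>q z. f (fst (fst z), p) (fst (snd z), q)"
          and g="\<lambda>z. snd (snd z)"]) measurable
  then have "(\<lambda>z. f (fst (fst z), snd (fst z)) (fst (snd z), snd (snd z))) \<in> measurable ?MN L"
    by (rule measurable_compose_countable[where f="\<lambda>p z. f (fst (fst z), p) (fst (snd z), snd (snd z))"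
          and g="\<lambda>z. snd (fst z)"]) measurable
  then show ?thesis by (simp add: case_prod_beta)
qed

context sigma_finite_measure
begin

lemma pair_count_space: "pair_sigma_finite M (count_space (UNIV :: 'q::finite set))"
  by (intro pair_sigma_finite.intro sigma_finite_measure_axioms sigma_finite_measure_count_space_countable) simp

lemma nn_integral_pair_count_space:
  assumes "f \<in> borel_measurable (M \<Otimes>\<^sub>M count_space (UNIV :: 'q::finite set))"
  shows "(\<integral>\<^sup>+z. f z \<partial>(M \<Otimes>\<^sub>M count_space UNIV)) = (\<Sum>q\<in>UNIV. \<integral>\<^sup>+x. f (x, q) \<partial>M)"
  by (subst pair_sigma_finite.nn_integral_snd[OF pair_count_space assms, symmetric])
    (simp add: nn_integral_count_space_finite)

lemma integral_pair_count_space: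
  fixes f :: "'a \<times> 'q::finite \<Rightarrow> real"
  assumes "integrable (M \<Otimes>\<^sub>M count_space UNIV) f"
  shows "(\<integral>z. f z \<partial>(M \<Otimes>\<^sub>M count_space UNIV)) = (\<Sum>q\<in>UNIV. \<integral>x. f (x, q) \<partial>M)"
  using pair_sigma_finite.integral_snd[OF pair_count_space, of "\<lambda>x q. f (x, q)"] assms
  by (simp add: lebesgue_integral_count_space_finite)

lemma integrable_pair_count_space:
  fixes f :: "'a \<times> 'q::finite \<Rightarrow> real"
  shows "integrable (M \<Otimes>\<^sub>M count_space UNIV) f \<longleftrightarrow> (\<forall>q. integrable M (\<lambda>x. f (x, q)))"
proof
  assume f: "integrable (M \<Otimes>\<^sub>M count_space UNIV) f"
  then have [measurable]: "f \<in> borel_measurable (M \<Otimes>\<^sub>M count_space UNIV)" by auto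
  have "(\<Sum>q\<in>UNIV. \<integral>\<^sup>+x. ennreal (norm (f (x, q))) \<partial>M) < \<infinity>"
    using f by (subst nn_integral_pair_count_space[symmetric]) (auto simp: integrable_iff_bounded)
  then show "\<forall>q. integrable M (\<lambda>x. f (x, q))"
    by (auto simp: integrable_iff_bounded)
next
  assume f: "\<forall>q. integrable M (\<lambda>x. f (x, q))"
  have [measurable]: "f \<in> borel_measurable (M \<Otimes>\<^sub>M count_space UNIV)"
    using f by (intro measurable_pair_count_space) auto
  show "integrable (M \<Otimes>\<^sub>M count_space UNIV) f"
    using f by (simp add: integrable_iff_bounded nn_integral_pair_count_space)
qed

text \<open>Each of the finitely many slices is approximated to within \<open>e / CARD('q)\<close>;
  there are countably many functions from a finite type into a countable set.\<close>

lemma L1_separable_pair_count_space: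
  assumes "\<exists>D. countable D \<and> L1_dense M D"
  shows "\<exists>D. countable D \<and> L1_dense (M \<Otimes>\<^sub>M count_space (UNIV :: 'q::finite set)) D"
proof -
  obtain D where D: "countable D" "L1_dense M D" using assms by blast
  define E where "E = (\<lambda>(c :: 'q \<Rightarrow> 'a \<Rightarrow> real) (x, q). c q x) ` (UNIV \<rightarrow>\<^sub>E D)"
  have int: "integrable (M \<Otimes>\<^sub>M count_space UNIV) e" if "e \<in> E" for e
    using that D(2) by (auto simp: E_def integrable_pair_count_space L1_dense_def)
  have "\<exists>d\<in>E. (\<integral>z. \<bar>f z - d z\<bar> \<partial>(M \<Otimes>\<^sub>M count_space UNIV)) < e"
    if f: "integrable (M \<Otimes>\<^sub>M count_space UNIV) f" and e: "0 < e" for f and e :: real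
  proof -
    have fq: "integrable M (\<lambda>x. f (x, q))" for q using f by (simp add: integrable_pair_count_space)
    have "0 < e / CARD('q)" using e by simp
    then have "\<exists>d\<in>D. (\<integral>x. \<bar>f (x, q) - d x\<bar> \<partial>M) < e / CARD('q)" for q
      using D(2) fq[of q] unfolding L1_dense_def by blast
    then obtain c where c: "\<And>q. c q \<in> D" "\<And>q. (\<integral>x. \<bar>f (x, q) - c q x\<bar> \<partial>M) < e / CARD('q)" by metis
    have cE: "(\<lambda>(x, q). c q x) \<in> E" using c(1) by (auto simp: E_def)
    have "(\<integral>z. \<bar>f z - (case z of (x, q) \<Rightarrow> c q x)\<bar> \<partial>(M \<Otimes>\<^sub>M count_space UNIV)) =
        (\<Sum>q\<in>UNIV. \<integral>x. \<bar>f (x, q) - c q x\<bar> \<partial>M)"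
      using f int[OF cE] by (subst integral_pair_count_space) auto
    also have "\<dots> < (\<Sum>q\<in>(UNIV :: 'q set). e / CARD('q))" using c(2) by (intro sum_strict_mono) auto
    finally show ?thesis using cE by (intro bexI[of _ "\<lambda>(x, q). c q x"]) auto
  qed
  moreover have "countable E" unfolding E_def using D(1) by (intro countable_image countable_PiE) auto
  ultimately show ?thesis using int unfolding L1_dense_def by blast
qed

end

text \<open>Since \<open>X\<close> need not be a Borel set, points outside \<open>A\<close> are first mapped to a fixed point of \<open>A\<close>.\<close>

lemma borel_measurable_indicator_mult_restrict_space:
  fixes f :: "'a \<Rightarrow> 'b::topological_space \<Rightarrow> real"
  assumes f: "case_prod f \<in> borel_measurable (N \<Otimes>\<^sub>M restrict_space borel X)"
    and A: "A \<in> sets borel" "A \<subseteq> X"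
  shows "(\<lambda>(y, x). indicator A x * f y x) \<in> borel_measurable (N \<Otimes>\<^sub>M borel)"
proof (cases "A = {}")
  case False
  then obtain a where "a \<in> A" by blast
  define g where "g x = (if x \<in> A then x else a)" for x
  have "g \<in> measurable borel (restrict_space borel X)"
    using A \<open>a \<in> A\<close> by (intro measurable_restrict_space2) (auto simp: g_def[abs_def])
  then have "(\<lambda>z. g (snd z)) \<in> measurable (N \<Otimes>\<^sub>M borel) (restrict_space borel X)"
    by (rule measurable_compose[OF measurable_snd])
  then have "(\<lambda>z. case_prod f (fst z, g (snd z))) \<in> borel_measurable (N \<Otimes>\<^sub>M borel)"
    by (intro measurable_compose[OF _ f] measurable_Pair) measurable
  then have "(\<lambda>z. indicator A (snd z) * case_prod f (fst z, g (snd z))) \<in> borel_measurable (N \<Otimes>\<^sub>M borel)"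
    using A(1) by measurable
  moreover have "(\<lambda>z. indicator A (snd z) * case_prod f (fst z, g (snd z))) = (\<lambda>(y, x). indicator A x * f y x)"
    by (auto simp: g_def fun_eq_iff indicator_def)
  ultimately show ?thesis by simp
qed simp

subsection \<open>The hybrid system\<close>

abbreviation state_measure :: "('n::finite, 'q::finite) state measure" where
  "state_measure \<equiv> lborel \<Otimes>\<^sub>M count_space UNIV"

text \<open>The two observation models differ in the reference measure \<open>R\<^sub>x\<close> for
  the observation of the continuous state and in the density \<open>l\<close> relative to it; with
  these as parameters both are treated at once.\<close>

locale hybrid_filter =
  fixes X :: "(real ^ 'n::finite) set"
    and K :: "('n, 'q::finite) state set"
    and U :: "'u::polish_space set"
    and Tq :: "'q \<Rightarrow> real ^ 'n \<Rightarrow> 'q \<Rightarrow> 'u \<Rightarrow> real"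
    and Tx :: "real ^ 'n \<Rightarrow> real ^ 'n \<Rightarrow> 'u \<Rightarrow> 'q \<Rightarrow> real"
    and Q :: "'q \<Rightarrow> 'yq::finite \<Rightarrow> 'u \<Rightarrow> real"
    and R\<^sub>x :: "'o measure"
    and l :: "'o \<Rightarrow> real ^ 'n \<Rightarrow> 'u \<Rightarrow> real"
  assumes system: "hybrid_system X K U Tq Tx"
    and mode_obs: "mode_observation U Q"
    and R\<^sub>x: "sigma_finite_measure R\<^sub>x"
    and l_measurable: "u \<in> U \<Longrightarrow> (\<lambda>(y, x). l y x u) \<in> borel_measurable (R\<^sub>x \<Otimes>\<^sub>M restrict_space borel X)"
    and l_nonneg: "u \<in> U \<Longrightarrow> x \<in> X \<Longrightarrow> y \<in> space R\<^sub>x \<Longrightarrow> 0 \<le> l y x u"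
    and l_mass: "u \<in> U \<Longrightarrow> x \<in> X \<Longrightarrow> (\<integral>\<^sup>+y. ennreal (l y x u) \<partial>R\<^sub>x) = 1"
begin

abbreviation obs_measure :: "('o \<times> 'yq) measure" where
  "obs_measure \<equiv> R\<^sub>x \<Otimes>\<^sub>M uniform_count_measure UNIV"

definition update :: "'o \<times> 'yq \<Rightarrow> 'u \<Rightarrow> (('n, 'q) state \<Rightarrow> real) \<Rightarrow> ('n, 'q) state \<Rightarrow> real" where
  "update = (\<lambda>(y, yq) u \<sigma> (x', q').
     if x' \<in> X then real CARD('yq) * Q q' yq u * l y x' u * safe_prediction K Tq Tx u \<sigma> (x', q') else 0)"

text \<open>The indicator is present because \<open>l\<close> is constrained at states of
  \<open>X\<close> only, and \<open>K\<close> lies over \<open>X\<close>.\<close>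

definition likelihood :: "'u \<Rightarrow> 'o \<times> 'yq \<Rightarrow> ('n, 'q) state \<Rightarrow> ennreal" where
  "likelihood = (\<lambda>u (y, yq) (x', q'). ennreal (real CARD('yq) * Q q' yq u * (indicator K (x', q') * l y x' u)))"

text \<open>The indicator restricts the state that is left, not the state that is entered.\<close>

definition safe_kernel :: "'u \<Rightarrow> ('n, 'q) state \<Rightarrow> ('n, 'q) state \<Rightarrow> ennreal" where
  "safe_kernel = (\<lambda>u (x', q') (x, q). ennreal (indicator K (x, q) * transition_kernel Tq Tx (x', q') (x, q) u))"

definition K\<^sub>q :: "'q \<Rightarrow> (real ^ 'n) set" where "K\<^sub>q q = {x. (x, q) \<in> K}"

lemma indicator_K\<^sub>q: "indicator K (x, q) = indicator (K\<^sub>q q) x"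
  by (simp add: K\<^sub>q_def indicator_def)

lemma
  shows K_measurable: "K \<in> sets (borel \<Otimes>\<^sub>M count_space UNIV)"
    and K_subset: "(x, q) \<in> K \<Longrightarrow> x \<in> X"
    and U_nonempty: "U \<noteq> {}"
    and Tq_measurable: "(\<lambda>(x, u). Tq q' x q u)
        \<in> borel_measurable (restrict_space borel X \<Otimes>\<^sub>M restrict_space borel U)"
    and Tq_nonneg: "x \<in> X \<Longrightarrow> u \<in> U \<Longrightarrow> 0 \<le> Tq q' x q u"
    and Tq_sum: "x \<in> X \<Longrightarrow> u \<in> U \<Longrightarrow> (\<Sum>q'\<in>UNIV. Tq q' x q u) = 1"
    and Tx_measurable: "(\<lambda>(x', x, u). Tx x' x u q')
        \<in> borel_measurable (borel \<Otimes>\<^sub>M (restrict_space borel X \<Otimes>\<^sub>M restrict_space borel U))"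
    and Tx_nonneg: "x \<in> X \<Longrightarrow> u \<in> U \<Longrightarrow> 0 \<le> Tx x' x u q'"
    and Tx_density: "x \<in> X \<Longrightarrow> u \<in> U \<Longrightarrow> has_bochner_integral lborel (\<lambda>x'. Tx x' x u q') 1"
    and Q_nonneg: "u \<in> U \<Longrightarrow> 0 \<le> Q q yq u"
    and Q_sum: "u \<in> U \<Longrightarrow> (\<Sum>yq\<in>UNIV. Q q yq u) = 1"
  using system mode_obs by (auto simp: hybrid_system_def mode_observation_def)

lemma K\<^sub>q_sets [measurable]: "K\<^sub>q q \<in> sets borel"
proof -
  have "(\<lambda>x. (x, q)) -` K \<in> sets borel"
    using sets_Pair2[OF K_measurable, of q] by simp
  then show ?thesis by (simp add: K\<^sub>q_def vimage_def)
qed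

lemma K\<^sub>q_subset: "K\<^sub>q q \<subseteq> X" by (auto simp: K\<^sub>q_def K_subset)

lemma K_sets_state [measurable]: "K \<in> sets state_measure"
proof -
  have "sets state_measure = sets (borel \<Otimes>\<^sub>M count_space (UNIV :: 'q set))"
    by (intro sets_pair_measure_cong) simp_all
  then show ?thesis using K_measurable by simp
qed

section \<open>Measurability and mass of the transition kernel\<close>

lemma transition_kernel_measurable:
  assumes u: "u \<in> U"
  shows "(\<lambda>(x', x). indicator (K\<^sub>q q) x * transition_kernel Tq Tx (x', q') (x, q) u)
    \<in> borel_measurable (borel \<Otimes>\<^sub>M borel)"
proof -
  have u': "u \<in> space (restrict_space borel U)" using u by (simp add: space_restrict_space)
  have "(\<lambda>z. (case (fst z, snd z, u) of (x', x, u) \<Rightarrow> Tx x' x u q') *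
      (case (snd z, u) of (x, u) \<Rightarrow> Tq q' x q u)) \<in> borel_measurable (borel \<Otimes>\<^sub>M restrict_space borel X)"
    by (intro borel_measurable_times measurable_compose[OF _ Tx_measurable] measurable_compose[OF _ Tq_measurable])
      (use u' in measurable)
  then have "(\<lambda>(x', x). Tx x' x u q' * Tq q' x q u) \<in> borel_measurable (borel \<Otimes>\<^sub>M restrict_space borel X)"
    by (simp add: case_prod_beta)
  from borel_measurable_indicator_mult_restrict_space[OF this K\<^sub>q_sets K\<^sub>q_subset]
  show ?thesis by (simp add: transition_kernel_def)
qed

lemma safe_kernel_measurable:
  assumes u: "u \<in> U"
  shows "case_prod (safe_kernel u) \<in> borel_measurable (state_measure \<Otimes>\<^sub>M state_measure)"
proof (rule measurable_pair_pair_count_space)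
  fix q' q :: 'q
  have "(\<lambda>z. ennreal (case z of (x', x) \<Rightarrow>
      indicator (K\<^sub>q q) x * transition_kernel Tq Tx (x', q') (x, q) u)) \<in> borel_measurable (borel \<Otimes>\<^sub>M borel)"
    by (intro measurable_compose[OF _ measurable_ennreal] transition_kernel_measurable[OF u])
  then show "(\<lambda>(x', x). safe_kernel u (x', q') (x, q)) \<in> borel_measurable (lborel \<Otimes>\<^sub>M lborel)"
    by (simp add: safe_kernel_def indicator_K\<^sub>q case_prod_beta cong: measurable_cong_sets)
qed

text \<open>Out of a safe state, each target mode \<open>q'\<close> contributes
  \<open>Tq q' x q u\<close>, because \<open>Tx\<close> integrates to 1, and these contributions add
  up to 1.\<close>

lemma safe_kernel_mass:
  assumes u: "u \<in> U"
  shows "(\<integral>\<^sup>+s'. safe_kernel u s' s \<partial>state_measure) = indicator K s"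
proof (cases s)
  case s: (Pair x q)
  show ?thesis
  proof (cases "(x, q) \<in> K")
    case False
    then show ?thesis by (simp add: s safe_kernel_def case_prod_beta)
  next
    case True
    then have x: "x \<in> X" by (rule K_subset)
    have m: "(\<lambda>s'. safe_kernel u s' s) \<in> borel_measurable state_measure"
      using measurable_Pair1[OF safe_kernel_measurable[OF u], of s] by (simp add: space_pair_measure)
    have "(\<integral>\<^sup>+x'. safe_kernel u (x', q') s \<partial>lborel) = ennreal (Tq q' x q u)" for q'
    proof -
      have "(\<integral>\<^sup>+x'. safe_kernel u (x', q') s \<partial>lborel) = (\<integral>\<^sup>+x'. ennreal (Tq q' x q u) * ennreal (Tx x' x u q') \<partial>lborel)"
        using True x u by (simp add: s safe_kernel_def transition_kernel_def ennreal_mult[symmetric] Tq_nonneg Tx_nonneg mult.commute)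
      also have "\<dots> = ennreal (Tq q' x q u) * (\<integral>\<^sup>+x'. ennreal (Tx x' x u q') \<partial>lborel)"
        using Tx_density[OF x u, of q'] by (intro nn_integral_cmult) (auto dest: has_bochner_integral_integrable integrable.intros)
      also have "(\<integral>\<^sup>+x'. ennreal (Tx x' x u q') \<partial>lborel) = 1"
        using Tx_density[OF x u, of q'] Tx_nonneg[OF x u]
        by (subst nn_integral_eq_integral) (auto simp: has_bochner_integral_iff)
      finally show ?thesis by simp
    qed
    then show ?thesis
      using True Tq_nonneg[OF x u] Tq_sum[OF x u]
      by (subst lborel.nn_integral_pair_count_space[OF m]) (auto simp: s sum_ennreal)
  qed
qed

lemma safe_kernel_mass_le: "u \<in> U \<Longrightarrow> (\<integral>\<^sup>+s'. safe_kernel u s' s \<partial>state_measure) \<le> 1"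
  by (simp add: safe_kernel_mass indicator_def)


section \<open>Prediction from safe states\<close>

lemma safe_prediction_integrand:
  assumes \<sigma>: "safe_statistic state_measure K \<sigma>" and u: "u \<in> U"
  shows "(\<lambda>(x', x). indicator K (x, q) * transition_kernel Tq Tx (x', q') (x, q) u * \<sigma> (x, q))
      \<in> borel_measurable (borel \<Otimes>\<^sub>M borel)"
    and "0 \<le> indicator K (x, q) * transition_kernel Tq Tx (x', q') (x, q) u * \<sigma> (x, q)"
    and "ennreal (indicator K (x, q) * transition_kernel Tq Tx (x', q') (x, q) u * \<sigma> (x, q)) =
      safe_kernel u (x', q') (x, q) * ennreal (indicator K (x, q) * \<sigma> (x, q))"
proof -
  have "integrable lborel (\<lambda>x. indicator K (x, q) * \<sigma> (x, q))"
    using \<sigma> by (auto simp: safe_statistic_def lborel.integrable_pair_count_space)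
  then have [measurable]: "(\<lambda>x. indicator K (x, q) * \<sigma> (x, q)) \<in> borel_measurable borel" by auto
  note [measurable] = transition_kernel_measurable[OF u]
  \<comment> \<open>The indicator is inserted twice, once for the kernel and once for \<sigma>:
    neither is known to be Borel measurable without it.\<close>
  have "(\<lambda>z. (case z of (x', x) \<Rightarrow> indicator (K\<^sub>q q) x * transition_kernel Tq Tx (x', q') (x, q) u) *
      (\<lambda>x. indicator K (x, q) * \<sigma> (x, q)) (snd z)) \<in> borel_measurable (borel \<Otimes>\<^sub>M borel)"
    by measurable
  moreover have "(\<lambda>z. (case z of (x', x) \<Rightarrow> indicator (K\<^sub>q q) x * transition_kernel Tq Tx (x', q') (x, q) u) *
      (\<lambda>x. indicator K (x, q) * \<sigma> (x, q)) (snd z)) =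
      (\<lambda>(x', x). indicator K (x, q) * transition_kernel Tq Tx (x', q') (x, q) u * \<sigma> (x, q))"
    by (auto simp: fun_eq_iff K\<^sub>q_def indicator_def)
  ultimately show "(\<lambda>(x', x). indicator K (x, q) * transition_kernel Tq Tx (x', q') (x, q) u * \<sigma> (x, q))
      \<in> borel_measurable (borel \<Otimes>\<^sub>M borel)" by simp
  have nn: "0 \<le> transition_kernel Tq Tx (x', q') (x, q) u" "0 \<le> \<sigma> (x, q)" if "(x, q) \<in> K"
    using that \<sigma> K_subset[OF that] u by (auto simp: transition_kernel_def Tx_nonneg Tq_nonneg safe_statistic_def)
  then show "0 \<le> indicator K (x, q) * transition_kernel Tq Tx (x', q') (x, q) u * \<sigma> (x, q)"
    by (cases "(x, q) \<in> K") auto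
  show "ennreal (indicator K (x, q) * transition_kernel Tq Tx (x', q') (x, q) u * \<sigma> (x, q)) =
      safe_kernel u (x', q') (x, q) * ennreal (indicator K (x, q) * \<sigma> (x, q))"
    using nn by (cases "(x, q) \<in> K") (auto simp: safe_kernel_def ennreal_mult)
qed

lemma safe_prediction_nonneg:
  assumes "safe_statistic state_measure K \<sigma>" "u \<in> U"
  shows "0 \<le> safe_prediction K Tq Tx u \<sigma> s'"
  using safe_prediction_integrand(2)[OF assms]
  by (cases s') (auto simp: safe_prediction_def intro!: sum_nonneg integral_nonneg)

lemma safe_prediction_measurable:
  assumes "safe_statistic state_measure K \<sigma>" "u \<in> U"
  shows "safe_prediction K Tq Tx u \<sigma> \<in> borel_measurable state_measure"
proof (rule measurable_pair_count_space)
  fix q'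
  have "(\<lambda>x'. \<integral>x. indicator K (x, q) * transition_kernel Tq Tx (x', q') (x, q) u * \<sigma> (x, q) \<partial>lborel)
      \<in> borel_measurable borel" for q
    using safe_prediction_integrand(1)[OF assms]
    by (intro lborel.borel_measurable_lebesgue_integral) (simp cong: measurable_cong_sets)
  then show "(\<lambda>x'. safe_prediction K Tq Tx u \<sigma> (x', q')) \<in> borel_measurable lborel"
    by (simp add: safe_prediction_def)
qed

text \<open>The Bochner integrals in \<open>safe_prediction\<close> agree with the extended integral
  wherever the latter is finite. Its integral over \<open>s'\<close> is at most the mass of \<sigma>
  on \<open>K\<close>, so it is finite almost everywhere; elsewhere a divergent summand defaults to
  0.\<close>

lemma safe_prediction_eq_nn_integral:
  assumes \<sigma>: "safe_statistic state_measure K \<sigma>" and u: "u \<in> U"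
  shows "AE s' in state_measure. ennreal (safe_prediction K Tq Tx u \<sigma> s') =
    (\<integral>\<^sup>+s. safe_kernel u s' s * ennreal (indicator K s * \<sigma> s) \<partial>state_measure)"
proof -
  interpret S: pair_sigma_finite "lborel :: (real ^ 'n) measure" "count_space (UNIV :: 'q set)"
    by (rule lborel.pair_count_space)
  define \<tau> where "\<tau> s = ennreal (indicator K s * \<sigma> s)" for s
  have \<sigma>K: "integrable state_measure (\<lambda>s. indicator K s * \<sigma> s)" "\<And>s. 0 \<le> indicator K s * \<sigma> s"
    using \<sigma> by (auto simp: safe_statistic_def indicator_def)
  have \<tau> [measurable]: "\<tau> \<in> borel_measurable state_measure"
    using \<sigma>K unfolding \<tau>_def[abs_def] by auto
  note [measurable] = safe_kernel_measurable[OF u]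
  have "(\<integral>\<^sup>+s'. \<integral>\<^sup>+s. safe_kernel u s' s * \<tau> s \<partial>state_measure \<partial>state_measure) \<le> (\<integral>\<^sup>+s. \<tau> s \<partial>state_measure)"
    by (intro nn_integral_kernel_le S.P.sigma_finite_measure_axioms safe_kernel_measurable \<tau> safe_kernel_mass_le u)
  also have "\<dots> < \<infinity>"
    using \<sigma>K by (simp add: \<tau>_def nn_integral_eq_integral)
  finally have "AE s' in state_measure. (\<integral>\<^sup>+s. safe_kernel u s' s * \<tau> s \<partial>state_measure) \<noteq> \<infinity>"
    by (intro nn_integral_PInf_AE) auto
  then show ?thesis
  proof eventually_elim
    case (elim s')
    obtain x' q' where s': "s' = (x', q')" by (cases s')
    let ?g = "\<lambda>q x. indicator K (x, q) * transition_kernel Tq Tx (x', q') (x, q) u * \<sigma> (x, q)"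
    have [measurable]: "(\<lambda>s. safe_kernel u s' s) \<in> borel_measurable state_measure"
      using measurable_Pair2[OF safe_kernel_measurable[OF u], of s'] by (simp add: space_pair_measure)
    have g_meas: "?g q \<in> borel_measurable borel" for q
      using measurable_Pair2[OF safe_prediction_integrand(1)[OF \<sigma> u], of x' q] by simp
    have eq: "(\<integral>\<^sup>+s. safe_kernel u s' s * \<tau> s \<partial>state_measure) = (\<Sum>q\<in>UNIV. \<integral>\<^sup>+x. ennreal (?g q x) \<partial>lborel)"
      by (subst lborel.nn_integral_pair_count_space, measurable)
        (auto simp: \<tau>_def s' safe_prediction_integrand(3)[OF \<sigma> u])
    then have fin: "(\<integral>\<^sup>+x. ennreal (?g q x) \<partial>lborel) < \<infinity>" for q
      using elim by (auto simp: less_top)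
    have "integrable lborel (?g q)" for q
      using fin[of q] g_meas[of q] safe_prediction_integrand(2)[OF \<sigma> u]
      by (intro integrableI_nonneg) auto
    then have "(\<integral>\<^sup>+x. ennreal (?g q x) \<partial>lborel) = ennreal (\<integral>x. ?g q x \<partial>lborel)" for q
      using safe_prediction_integrand(2)[OF \<sigma> u] by (intro nn_integral_eq_integral) auto
    then have "(\<Sum>q\<in>UNIV. \<integral>\<^sup>+x. ennreal (?g q x) \<partial>lborel) = ennreal (\<Sum>q\<in>UNIV. \<integral>x. ?g q x \<partial>lborel)"
      using safe_prediction_integrand(2)[OF \<sigma> u] by (simp add: sum_ennreal integral_nonneg)
    then show ?case unfolding \<tau>_def[symmetric] eq by (simp add: safe_prediction_def s')
  qed
qed

section \<open>Likelihood of the observations\<close>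

lemma likelihood_measurable:
  assumes u: "u \<in> U"
  shows "case_prod (likelihood u) \<in> borel_measurable (obs_measure \<Otimes>\<^sub>M state_measure)"
proof -
  have m: "case_prod (likelihood u) \<in> borel_measurable ((R\<^sub>x \<Otimes>\<^sub>M count_space UNIV) \<Otimes>\<^sub>M (lborel \<Otimes>\<^sub>M count_space UNIV))"
  proof (rule measurable_pair_pair_count_space)
    fix yq :: 'yq and q' :: 'q
    have [measurable]: "(\<lambda>(y, x). indicator (K\<^sub>q q') x * l y x u) \<in> borel_measurable (R\<^sub>x \<Otimes>\<^sub>M borel)"
      by (rule borel_measurable_indicator_mult_restrict_space[OF l_measurable[OF u] K\<^sub>q_sets K\<^sub>q_subset])
    have m: "(\<lambda>z. ennreal (real CARD('yq) * Q q' yq u * (case z of (y, x) \<Rightarrow> indicator (K\<^sub>q q') x * l y x u)))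
        \<in> borel_measurable (R\<^sub>x \<Otimes>\<^sub>M borel)"
      by measurable
    have "sets (R\<^sub>x \<Otimes>\<^sub>M (borel :: (real ^ 'n) measure)) = sets (R\<^sub>x \<Otimes>\<^sub>M lborel)"
      by (intro sets_pair_measure_cong) simp_all
    from m[unfolded measurable_cong_sets[OF this refl]] show "(\<lambda>(y, x). likelihood u (y, yq) (x, q')) \<in> borel_measurable (R\<^sub>x \<Otimes>\<^sub>M lborel)"
      by (simp add: likelihood_def indicator_K\<^sub>q case_prod_beta)
  qed
  have eq: "sets (obs_measure \<Otimes>\<^sub>M state_measure) =
      sets ((R\<^sub>x \<Otimes>\<^sub>M count_space UNIV) \<Otimes>\<^sub>M (lborel \<Otimes>\<^sub>M count_space (UNIV :: 'q set)))"
    by (intro sets_pair_measure_cong sets_uniform_count_measure_count_space refl)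
  show ?thesis using m unfolding measurable_cong_sets[OF eq refl] .
qed

text \<open>\<open>CARD('yq)\<close> cancels the weights of the uniform measure, \<open>l\<close>
  has mass 1 and \<open>Q\<close> sums to 1, so a safe state has total likelihood 1 and an unsafe
  one 0.\<close>

lemma likelihood_mass:
  assumes u: "u \<in> U"
  shows "(\<integral>\<^sup>+y. likelihood u y s \<partial>obs_measure) \<le> 1"
proof (cases s)
  case s: (Pair x q)
  interpret R\<^sub>x: sigma_finite_measure R\<^sub>x by (rule R\<^sub>x)
  interpret C: prob_space "uniform_count_measure (UNIV :: 'yq set)"
    by (rule prob_space_uniform_count_measure) simp_all
  interpret O: pair_sigma_finite R\<^sub>x "uniform_count_measure (UNIV :: 'yq set)" ..
  show ?thesis
  proof (cases "(x, q) \<in> K")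
    case False
    then show ?thesis by (simp add: s likelihood_def case_prod_beta)
  next
    case True
    then have x: "x \<in> X" by (rule K_subset)
    have [measurable]: "(\<lambda>y. likelihood u y s) \<in> borel_measurable obs_measure"
      using measurable_Pair1[OF likelihood_measurable[OF u], of s] by (simp add: space_pair_measure)
    have [measurable]: "(\<lambda>y. l y x u) \<in> borel_measurable R\<^sub>x"
      using measurable_Pair1[OF l_measurable[OF u], of x] x by (simp add: space_restrict_space)
    have "(\<integral>\<^sup>+y. likelihood u (y, yq) s \<partial>R\<^sub>x) = ennreal (real CARD('yq) * Q q yq u)" for yq
    proof -
      have "(\<integral>\<^sup>+y. likelihood u (y, yq) s \<partial>R\<^sub>x) = (\<integral>\<^sup>+y. ennreal (real CARD('yq) * Q q yq u) * ennreal (l y x u) \<partial>R\<^sub>x)"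
        using True x u by (intro nn_integral_cong) (simp add: s likelihood_def ennreal_mult l_nonneg Q_nonneg)
      also have "\<dots> = ennreal (real CARD('yq) * Q q yq u) * 1"
        by (subst nn_integral_cmult) (auto simp: l_mass[OF u x])
      finally show ?thesis by simp
    qed
    then have "(\<integral>\<^sup>+y. likelihood u y s \<partial>obs_measure) =
        (\<integral>\<^sup>+yq. ennreal (real CARD('yq) * Q q yq u) \<partial>uniform_count_measure UNIV)"
      by (subst O.nn_integral_snd[symmetric]) auto
    also have "\<dots> = (\<Sum>yq\<in>(UNIV :: 'yq set). ennreal (Q q yq u))"
      unfolding uniform_count_measure_def
      by (subst nn_integral_point_measure_finite) (auto simp: ennreal_mult[symmetric] Q_nonneg u)
    also have "\<dots> = 1" using Q_sum[OF u] Q_nonneg[OF u] by (simp add: sum_ennreal)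
    finally show ?thesis by simp
  qed
qed

sublocale safe_filter state_measure obs_measure K U update likelihood safe_kernel
proof -
  interpret R\<^sub>x: sigma_finite_measure R\<^sub>x by (rule R\<^sub>x)
  interpret C: prob_space "uniform_count_measure (UNIV :: 'yq set)"
    by (rule prob_space_uniform_count_measure) simp_all
  interpret O: pair_sigma_finite R\<^sub>x "uniform_count_measure (UNIV :: 'yq set)" ..
  interpret S: pair_sigma_finite "lborel :: (real ^ 'n) measure" "count_space (UNIV :: 'q set)"
    by (rule lborel.pair_count_space)
  have l_meas: "(\<lambda>x. indicator (K\<^sub>q q') x * l y x u) \<in> borel_measurable borel"
    if "u \<in> U" "y \<in> space R\<^sub>x" for u y q'
    using measurable_Pair2[OF borel_measurable_indicator_mult_restrict_space[OF l_measurable[OF \<open>u \<in> U\<close>] K\<^sub>q_sets K\<^sub>q_subset],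
        OF \<open>y \<in> space R\<^sub>x\<close>, of q'] by simp
  \<comment> \<open>\<open>K\<close> lies over \<open>X\<close>, so the case distinction in
    \<open>update\<close> disappears under the indicator.\<close>
  have eq: "indicator K (x', q') * update (y, yq) u \<sigma> (x', q') =
      real CARD('yq) * Q q' yq u * (indicator K (x', q') * l y x' u) * safe_prediction K Tq Tx u \<sigma> (x', q')"
    for x' q' y yq u \<sigma>
    using K_subset[of x' q'] by (auto simp: update_def indicator_def)
  show "safe_filter state_measure obs_measure K U update likelihood safe_kernel"
  proof
    show "\<exists>D. countable D \<and> L1_dense (state_measure :: ('n, 'q) state measure) D"
      by (rule lborel.L1_separable_pair_count_space[OF L1_separable_lborel])
    show "0 \<le> update y u \<sigma> s" if \<sigma>: "safe_statistic state_measure K \<sigma>" and u: "u \<in> U" and y: "y \<in> space obs_measure"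
      for \<sigma> u y s
      using safe_prediction_nonneg[OF \<sigma> u] y l_nonneg[OF u] Q_nonneg[OF u]
      by (cases s; cases y) (auto simp: update_def space_pair_measure)
    show "(\<lambda>s. indicator K s * update y u \<sigma> s) \<in> borel_measurable state_measure"
      if \<sigma>: "safe_statistic state_measure K \<sigma>" and u: "u \<in> U" and y: "y \<in> space obs_measure" for \<sigma> u y
    proof (rule measurable_pair_count_space)
      fix q' :: 'q
      obtain y' yq where y': "y = (y', yq)" "y' \<in> space R\<^sub>x" using y by (auto simp: space_pair_measure)
      have [measurable]: "(\<lambda>x'. safe_prediction K Tq Tx u \<sigma> (x', q')) \<in> borel_measurable borel"
        using measurable_Pair1[OF safe_prediction_measurable[OF \<sigma> u], of q'] by simp
      note [measurable] = l_meas[OF u y'(2), of q']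
      show "(\<lambda>x. indicator K (x, q') * update y u \<sigma> (x, q')) \<in> borel_measurable lborel"
        unfolding y'(1) eq unfolding indicator_K\<^sub>q by measurable
    qed
    \<comment> \<open>The null set comes from the prediction, which does not involve the
      observation; hence it is the same for all \<open>y\<close>.\<close>
    show "AE s' in state_measure. \<forall>y\<in>space obs_measure. ennreal (indicator K s' * update y u \<sigma> s') =
        likelihood u y s' * (\<integral>\<^sup>+s. safe_kernel u s' s * ennreal (indicator K s * \<sigma> s) \<partial>state_measure)"
      if \<sigma>: "safe_statistic state_measure K \<sigma>" and u: "u \<in> U" for \<sigma> u
      using safe_prediction_eq_nn_integral[OF \<sigma> u]
    proof eventually_elim
      case (elim s')
      obtain x' q' where s': "s' = (x', q')" by (cases s')
      show ?case
      proof
        fix y assume "y \<in> space obs_measure"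
        then obtain y' yq where y: "y = (y', yq)" "y' \<in> space R\<^sub>x" by (auto simp: space_pair_measure)
        have "0 \<le> indicator K (x', q') * l y' x' u"
          using K_subset[of x' q'] l_nonneg[OF u _ y(2)] by (auto simp: indicator_def)
        then show "ennreal (indicator K s' * update y u \<sigma> s') =
            likelihood u y s' * (\<integral>\<^sup>+s. safe_kernel u s' s * ennreal (indicator K s * \<sigma> s) \<partial>state_measure)"
          using elim unfolding s' y(1) eq
          by (simp add: likelihood_def ennreal_mult'' safe_prediction_nonneg[OF \<sigma> u])
      qed
    qed
  qed (simp_all add: K_sets_state U_nonempty safe_kernel_measurable safe_kernel_mass likelihood_measurable likelihood_mass)
qed

section \<open>Value functions as suprema of pairings\<close>

lemma represents_value_function:
  assumes "t \<le> T"
  shows "\<exists>\<Gamma>. represents \<Gamma> (value_function T K U obs_measure update t)"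
  using assms
proof (induction t rule: inc_induct)
  case base
  \<comment> \<open>At the horizon the family has \<open>indicator K\<close> as its single
    member.\<close>
  have w: "indicator K \<in> safe_weights" by (auto simp: safe_weights_def)
  have "value_function T K U obs_measure update T \<sigma> = (SUP a\<in>{indicator K}. \<integral>\<^sup>+s. ennreal (a s * \<sigma> s) \<partial>state_measure)"
    if \<sigma>: "safe_statistic state_measure K \<sigma>" for \<sigma>
  proof -
    have "pairing \<sigma> (indicator K) = (\<integral>s. indicator K s * \<sigma> s \<partial>state_measure)"
      using \<sigma> by (subst lborel.integral_pair_count_space) (auto simp: pairing_def mult.commute safe_statistic_def)
    then show ?thesis
      by (subst value_function.simps) (simp add: safe_weight_nn_integral[OF w \<sigma>])
  qed
  with w show ?case by (intro exI[of _ "{indicator K}"]) (auto simp: represents_def)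
next
  case (step t)
  then obtain \<Gamma> where "represents \<Gamma> (value_function T K U obs_measure update (Suc t))" by blast
  moreover have "value_function T K U obs_measure update t =
      (\<lambda>\<sigma>. SUP u\<in>U. \<integral>\<^sup>+y. value_function T K U obs_measure update (Suc t) (update y u \<sigma>) \<partial>obs_measure)"
    using step.hyps by (intro ext, subst value_function.simps) simp
  ultimately show ?case using represents_backup by simp
qed

text \<open>The bound by 1 gives integrability against every sufficient statistic, and vanishing off
  \<open>K\<close> gives vanishing off \<open>X\<close>.\<close>

lemma safe_weight_alpha_function:
  assumes a: "a \<in> safe_weights"
  shows "alpha_function X a"
proof -
  have "a (x, q) = 0" if "x \<notin> X" for x q using safe_weightsD(5)[OF a] K_subset that by blast
  moreover have m: "(\<lambda>x. a (x, q)) \<in> borel_measurable borel" for q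
    using measurable_Pair1[OF safe_weightsD(1)[OF a], of q] by simp
  moreover have "integrable lborel (\<lambda>x. a (x, q) * \<sigma> (x, q))" if "sufficient_statistic X \<sigma>" for \<sigma> q
    using that m safe_weightsD(2,4)[OF a]
    by (intro integrable_mult_bounded) (auto simp: sufficient_statistic_def)
  ultimately show ?thesis by (auto simp: alpha_function_def)
qed

lemma sufficient_statistic_safe:
  assumes "sufficient_statistic X \<sigma>"
  shows "safe_statistic state_measure K \<sigma>"
proof -
  have "integrable state_measure \<sigma>"
    using assms by (auto simp: lborel.integrable_pair_count_space sufficient_statistic_def)
  then have "integrable state_measure (\<lambda>s. indicator K s * \<sigma> s)"
    by (intro integrable_mult_bounded) auto
  then show ?thesis using assms by (auto simp: safe_statistic_def sufficient_statistic_def)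
qed

text \<open>All pairings lie between 0 and the integral of
  \<open>indicator K s * \<sigma> s\<close>. The extended supremum provided by
  \<open>represents\<close> is therefore finite and equals the supremum in the reals.\<close>

theorem value_function_eq_SUP_pairing:
  assumes "t \<le> T"
  shows "\<exists>\<Gamma>. \<Gamma> \<noteq> {} \<and> (\<forall>\<alpha>\<in>\<Gamma>. alpha_function X \<alpha>) \<and>
     (\<forall>\<sigma>. sufficient_statistic X \<sigma> \<longrightarrow>
        bdd_above ((\<lambda>\<alpha>. pairing \<alpha> \<sigma>) ` \<Gamma>) \<and>
        enn2ereal (value_function T K U obs_measure update t \<sigma>) = ereal (SUP \<alpha>\<in>\<Gamma>. pairing \<alpha> \<sigma>))"
proof -
  obtain \<Gamma> where \<Gamma>: "represents \<Gamma> (value_function T K U obs_measure update t)"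
    using represents_value_function[OF assms] by blast
  then have ne: "\<Gamma> \<noteq> {}" and w: "\<And>a. a \<in> \<Gamma> \<Longrightarrow> a \<in> safe_weights" by (auto simp: represents_def)
  have "bdd_above ((\<lambda>\<alpha>. pairing \<alpha> \<sigma>) ` \<Gamma>) \<and>
      enn2ereal (value_function T K U obs_measure update t \<sigma>) = ereal (SUP \<alpha>\<in>\<Gamma>. pairing \<alpha> \<sigma>)"
    if \<sigma>: "sufficient_statistic X \<sigma>" for \<sigma>
  proof -
    note \<sigma>' = sufficient_statistic_safe[OF \<sigma>]
    let ?\<sigma> = "\<lambda>s. indicator K s * \<sigma> s"
    have pair: "pairing a \<sigma> = (\<integral>s. a s * \<sigma> s \<partial>state_measure)" if "a \<in> \<Gamma>" for a
      using safe_weight_integrable[OF w[OF that] \<sigma>']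
      by (subst lborel.integral_pair_count_space) (auto simp: pairing_def)
    have nonneg: "0 \<le> pairing a \<sigma>" if "a \<in> \<Gamma>" for a
      using safe_weight_nonneg[OF w[OF that] \<sigma>'] by (simp add: pair[OF that])
    have "pairing a \<sigma> \<le> (\<integral>s. ?\<sigma> s \<partial>state_measure)" if "a \<in> \<Gamma>" for a
      unfolding pair[OF that]
    proof (rule integral_mono)
      show "integrable state_measure (\<lambda>s. a s * \<sigma> s)" by (rule safe_weight_integrable[OF w[OF that] \<sigma>'])
      show "integrable state_measure ?\<sigma>" using \<sigma>' by (simp add: safe_statistic_def)
      show "a s * \<sigma> s \<le> ?\<sigma> s" for s
        using safe_weightsD(3)[OF w[OF that], of s] \<sigma>
        by (cases s) (auto simp: sufficient_statistic_def intro: mult_right_mono)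
    qed
    then have bdd: "bdd_above ((\<lambda>\<alpha>. pairing \<alpha> \<sigma>) ` \<Gamma>)" by (intro bdd_aboveI2)
    have "value_function T K U obs_measure update t \<sigma> = (SUP a\<in>\<Gamma>. \<integral>\<^sup>+s. ennreal (a s * \<sigma> s) \<partial>state_measure)"
      using \<Gamma> \<sigma>' by (simp add: represents_def)
    also have "\<dots> = (SUP a\<in>\<Gamma>. ennreal (pairing a \<sigma>))"
      by (intro SUP_cong refl) (simp add: safe_weight_nn_integral[OF w \<sigma>'] pair)
    also have "\<dots> = ennreal (SUP a\<in>\<Gamma>. pairing a \<sigma>)"
    proof (rule ennreal_SUP[symmetric, OF _ ne])
      have "(SUP a\<in>\<Gamma>. ennreal (pairing a \<sigma>)) \<le> ennreal (SUP a\<in>\<Gamma>. pairing a \<sigma>)"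
        by (intro SUP_least ennreal_leI cSUP_upper bdd)
      then show "(SUP a\<in>\<Gamma>. ennreal (pairing a \<sigma>)) \<noteq> top" by (rule neq_top_trans[rotated]) simp
    qed
    finally have V: "value_function T K U obs_measure update t \<sigma> = ennreal (SUP a\<in>\<Gamma>. pairing a \<sigma>)" .
    obtain a where "a \<in> \<Gamma>" using ne by blast
    \<comment> \<open>\<open>ennreal\<close> sends negative numbers to 0, so the sign has to be
      known before converting back.\<close>
    then have "0 \<le> (SUP a\<in>\<Gamma>. pairing a \<sigma>)"
      using nonneg by (intro cSUP_upper2[OF bdd]) auto
    then show ?thesis using bdd by (simp add: V enn2ereal_ennreal)
  qed
  then show ?thesis using ne w safe_weight_alpha_function by blast
qed

end

section \<open>The continuous and the discrete observation model\<close>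

lemma nn_integral_lborel_diff:
  fixes f :: "'a::euclidean_space \<Rightarrow> ennreal"
  assumes [measurable]: "f \<in> borel_measurable borel"
  shows "(\<integral>\<^sup>+x. f (x - c) \<partial>lborel) = (\<integral>\<^sup>+x. f x \<partial>lborel)"
proof -
  have "(\<integral>\<^sup>+x. f x \<partial>lborel) = (\<integral>\<^sup>+x. f x \<partial>distr lborel borel ((+) (- c)))"
    by (simp add: lborel_distr_plus)
  also have "\<dots> = (\<integral>\<^sup>+x. f (x - c) \<partial>lborel)"
    by (subst nn_integral_distr) (auto simp: algebra_simps)
  finally show ?thesis by simp
qed

text \<open>The density of the reference measure cancels the denominator and leaves
  \<open>\<phi> (y - h x u)\<close>, whose integral over \<open>y\<close> is 1 by translation
  invariance.\<close>

lemma hybrid_filter_continuous: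
  assumes "hybrid_system X K U Tq Tx" "mode_observation U Q"
    and obs: "continuous_observation X U h \<phi>"
  shows "hybrid_filter X K U Tq Tx Q (density lborel (\<lambda>v. ennreal (\<phi> v)))
    (\<lambda>y x u. \<phi> (y - h x u) / \<phi> y)"
proof -
  have h: "continuous_on (X \<times> U) (\<lambda>(x, u). h x u)" and pos: "\<And>v. 0 < \<phi> v"
    and \<phi>: "has_bochner_integral lborel \<phi> 1"
    using obs by (auto simp: continuous_observation_def)
  have [measurable]: "\<phi> \<in> borel_measurable borel"
    using \<phi> by (auto simp: has_bochner_integral_iff)
  have \<phi>_mass: "(\<integral>\<^sup>+v. ennreal (\<phi> v) \<partial>lborel) = 1"
    using \<phi> pos by (subst nn_integral_eq_integral) (auto simp: has_bochner_integral_iff less_imp_le)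
  show ?thesis
  proof (intro hybrid_filter.intro assms)
    show "sigma_finite_measure (density lborel (\<lambda>v. ennreal (\<phi> v)))"
      using \<phi>_mass by (intro finite_measure.axioms(1) finite_measureI) (simp add: emeasure_density)
    fix u assume u: "u \<in> U"
    have "continuous_on X (\<lambda>x. (\<lambda>(x, u). h x u) (x, u))"
      by (rule continuous_on_compose2[OF h]) (use u in \<open>auto intro!: continuous_intros\<close>)
    then have [measurable]: "(\<lambda>x. h x u) \<in> borel_measurable (restrict_space borel X)"
      by (simp add: borel_measurable_continuous_on_restrict)
    show "(\<lambda>(y, x). \<phi> (y - h x u) / \<phi> y)
        \<in> borel_measurable (density lborel (\<lambda>v. ennreal (\<phi> v)) \<Otimes>\<^sub>M restrict_space borel X)"
      by measurable
    show "0 \<le> \<phi> (y - h x u) / \<phi> y" for x y using pos by (simp add: less_imp_le)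
    show "(\<integral>\<^sup>+y. ennreal (\<phi> (y - h x u) / \<phi> y) \<partial>density lborel (\<lambda>v. ennreal (\<phi> v))) = 1" for x
    proof -
      have "(\<integral>\<^sup>+y. ennreal (\<phi> (y - h x u) / \<phi> y) \<partial>density lborel (\<lambda>v. ennreal (\<phi> v))) =
          (\<integral>\<^sup>+y. ennreal (\<phi> (y - h x u)) \<partial>lborel)"
      proof (subst nn_integral_density, measurable, intro nn_integral_cong)
        fix y
        show "ennreal (\<phi> y) * ennreal (\<phi> (y - h x u) / \<phi> y) = ennreal (\<phi> (y - h x u))"
          using pos[of y] pos[of "y - h x u"] by (simp add: ennreal_mult[symmetric])
      qed
      also have "\<dots> = 1" using nn_integral_lborel_diff[of "\<lambda>v. ennreal (\<phi> v)"] \<phi>_mass by simp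
      finally show ?thesis .
    qed
  qed
qed

text \<open>The uniform reference measure gives each value the weight \<open>1 / CARD('yx)\<close>,
  so the density relative to it carries the factor \<open>CARD('yx)\<close>.\<close>

lemma hybrid_filter_discrete:
  fixes \<phi> :: "'yx::finite \<Rightarrow> real ^ 'n::finite \<Rightarrow> 'u::polish_space \<Rightarrow> real"
  assumes "hybrid_system X K U Tq Tx" "mode_observation U Q"
    and obs: "discrete_observation X U \<phi>"
  shows "hybrid_filter X K U Tq Tx Q (uniform_count_measure UNIV) (\<lambda>y x u. real CARD('yx) * \<phi> y x u)"
proof -
  have meas: "\<And>y. (\<lambda>(x, u). \<phi> y x u) \<in> borel_measurable (restrict_space borel X \<Otimes>\<^sub>M restrict_space borel U)"
    and nonneg: "\<And>x u y. x \<in> X \<Longrightarrow> u \<in> U \<Longrightarrow> 0 \<le> \<phi> y x u"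
    and mass: "\<And>x u. x \<in> X \<Longrightarrow> u \<in> U \<Longrightarrow> (\<Sum>y\<in>UNIV. \<phi> y x u) = 1"
    using obs by (auto simp: discrete_observation_def)
  interpret C: prob_space "uniform_count_measure (UNIV :: 'yx set)"
    by (rule prob_space_uniform_count_measure) simp_all
  show ?thesis
  proof (intro hybrid_filter.intro assms)
    show "sigma_finite_measure (uniform_count_measure (UNIV :: 'yx set))" ..
    fix u assume u: "u \<in> U"
    have [measurable]: "(\<lambda>x. \<phi> y x u) \<in> borel_measurable (restrict_space borel X)" for y
      using measurable_Pair1[OF meas[of y], of u] u by (simp add: space_restrict_space)
    have "(\<lambda>(y, x). real CARD('yx) * \<phi> y x u) \<in> borel_measurable (count_space UNIV \<Otimes>\<^sub>M restrict_space borel X)"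
      by (rule measurable_pair_measure_countable1) simp_all
    moreover have eq: "sets (uniform_count_measure (UNIV :: 'yx set) \<Otimes>\<^sub>M restrict_space borel X) =
        sets (count_space UNIV \<Otimes>\<^sub>M restrict_space borel X)"
      by (intro sets_pair_measure_cong sets_uniform_count_measure_count_space refl)
    ultimately show "(\<lambda>(y, x). real CARD('yx) * \<phi> y x u)
        \<in> borel_measurable (uniform_count_measure UNIV \<Otimes>\<^sub>M restrict_space borel X)"
      unfolding measurable_cong_sets[OF eq refl] by blast
    fix x assume x: "x \<in> X"
    show "0 \<le> real CARD('yx) * \<phi> y x u" for y using nonneg[OF x u] by simp
    have "(\<integral>\<^sup>+y. ennreal (real CARD('yx) * \<phi> y x u) \<partial>uniform_count_measure UNIV) =
        (\<Sum>y\<in>UNIV. ennreal (\<phi> y x u))"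
      unfolding uniform_count_measure_def
      by (subst nn_integral_point_measure_finite) (auto simp: ennreal_mult[symmetric] nonneg[OF x u])
    also have "\<dots> = 1" using nonneg[OF x u] mass[OF x u] by (simp add: sum_ennreal)
    finally show "(\<integral>\<^sup>+y. ennreal (real CARD('yx) * \<phi> y x u) \<partial>uniform_count_measure UNIV) = 1" .
  qed
qed

theorem lemma2:
  fixes X :: "(real ^ 'n::finite) set"
    and K :: "('n, 'q::finite) state set"
    and U :: "'u::polish_space set"
    and Tq :: "'q \<Rightarrow> real ^ 'n \<Rightarrow> 'q \<Rightarrow> 'u \<Rightarrow> real"
    and Tx :: "real ^ 'n \<Rightarrow> real ^ 'n \<Rightarrow> 'u \<Rightarrow> 'q \<Rightarrow> real"
    and Q :: "'q \<Rightarrow> 'yq::finite \<Rightarrow> 'u \<Rightarrow> real"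
    and h :: "real ^ 'n \<Rightarrow> 'u \<Rightarrow> real ^ 'n"
    and \<phi>c :: "real ^ 'n \<Rightarrow> real"
    and \<phi>d :: "'yx::finite \<Rightarrow> real ^ 'n \<Rightarrow> 'u \<Rightarrow> real"
    and T :: nat
  assumes "hybrid_system X K U Tq Tx"
    and "mode_observation U Q"
  shows "(continuous_observation X U h \<phi>c \<longrightarrow>
           (\<forall>t\<in>{0..T}. \<exists>\<Gamma>. \<Gamma> \<noteq> {} \<and> (\<forall>\<alpha>\<in>\<Gamma>. alpha_function X \<alpha>) \<and>
              (\<forall>\<sigma>. sufficient_statistic X \<sigma> \<longrightarrow>
                 bdd_above ((\<lambda>\<alpha>. pairing \<alpha> \<sigma>) ` \<Gamma>) \<and>
                 enn2ereal (value_function T K U (reference_continuous \<phi>c)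
                     (update_continuous X K Tq Tx Q h \<phi>c) t \<sigma>) =
                   ereal (SUP \<alpha>\<in>\<Gamma>. pairing \<alpha> \<sigma>))))
       \<and> (discrete_observation X U \<phi>d \<longrightarrow>
           (\<forall>t\<in>{0..T}. \<exists>\<Gamma>. \<Gamma> \<noteq> {} \<and> (\<forall>\<alpha>\<in>\<Gamma>. alpha_function X \<alpha>) \<and>
              (\<forall>\<sigma>. sufficient_statistic X \<sigma> \<longrightarrow>
                 bdd_above ((\<lambda>\<alpha>. pairing \<alpha> \<sigma>) ` \<Gamma>) \<and>
                 enn2ereal (value_function T K U reference_discrete
                     (update_discrete X K Tq Tx Q \<phi>d) t \<sigma>) =
                   ereal (SUP \<alpha>\<in>\<Gamma>. pairing \<alpha> \<sigma>))))"
proof (intro conjI impI ballI)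
  fix t assume "t \<in> {0..T}"
  then have t: "t \<le> T" by simp
  show "\<exists>\<Gamma>. \<Gamma> \<noteq> {} \<and> (\<forall>\<alpha>\<in>\<Gamma>. alpha_function X \<alpha>) \<and>
      (\<forall>\<sigma>. sufficient_statistic X \<sigma> \<longrightarrow>
         bdd_above ((\<lambda>\<alpha>. pairing \<alpha> \<sigma>) ` \<Gamma>) \<and>
         enn2ereal (value_function T K U (reference_continuous \<phi>c)
             (update_continuous X K Tq Tx Q h \<phi>c) t \<sigma>) = ereal (SUP \<alpha>\<in>\<Gamma>. pairing \<alpha> \<sigma>))"
    if "continuous_observation X U h \<phi>c"
  proof -
    interpret hybrid_filter X K U Tq Tx Q "density lborel (\<lambda>v. ennreal (\<phi>c v))" "\<lambda>y x u. \<phi>c (y - h x u) / \<phi>c y"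
      by (rule hybrid_filter_continuous[OF assms that])
    have "update_continuous X K Tq Tx Q h \<phi>c = update"
      by (simp add: update_continuous_def update_def)
    then show ?thesis
      using value_function_eq_SUP_pairing[OF t] by (simp add: reference_continuous_def)
  qed
  show "\<exists>\<Gamma>. \<Gamma> \<noteq> {} \<and> (\<forall>\<alpha>\<in>\<Gamma>. alpha_function X \<alpha>) \<and>
      (\<forall>\<sigma>. sufficient_statistic X \<sigma> \<longrightarrow>
         bdd_above ((\<lambda>\<alpha>. pairing \<alpha> \<sigma>) ` \<Gamma>) \<and>
         enn2ereal (value_function T K U reference_discrete
             (update_discrete X K Tq Tx Q \<phi>d) t \<sigma>) = ereal (SUP \<alpha>\<in>\<Gamma>. pairing \<alpha> \<sigma>))"
    if "discrete_observation X U \<phi>d"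
  proof -
    interpret hybrid_filter X K U Tq Tx Q "uniform_count_measure UNIV" "\<lambda>y x u. real CARD('yx) * \<phi>d y x u"
      by (rule hybrid_filter_discrete[OF assms that])
    \<comment> \<open>The factor \<open>real CARD('yx)\<close> is part of \<open>l\<close> here, so
      the two operators agree up to the order of the factors.\<close>
    have "update_discrete X K Tq Tx Q \<phi>d = update"
      by (auto simp: update_discrete_def update_def fun_eq_iff mult_ac)
    then show ?thesis
      using value_function_eq_SUP_pairing[OF t] by (simp add: reference_discrete_def)
  qed
qed

end
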